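(* Let $X$ be a geometrically integral projective scheme over a number field $K$. Let $\overline D=(D,g)$ be an adelic arithmetic $\mathbb R$-Cartier divisor on $X$ such that $D$ is big and $\widehat\mu_{\max}^{\mathrm{asy}}(\overline D)=0$. If $s\in\mathrm{Rat}(X)^\times_{\mathbb R}$ satisfies $\overline D+\widehat{(s)}\ge0$, then $$\mathrm{Supp}\big(\Psi_{\overline D,v}^{\widehat\mu_{\max}^{\mathrm{asy}}}\big)\cap\{x\in X_v^{\mathrm{an}}:|s|_{g_v}(x)<1\}=\varnothing$$ for every $v\in M_K\cup K(\mathbb C)$.
   Context: Notation: $O_K$ is the ring of integers of $K$, $M_K$ the set of its maximal ideals, $K(\mathbb C)$ the set of embeddings $K\hookrightarrow\mathbb C$. For $v=\mathfrak p\in M_K$, $K_v$ is the completion of $K$ at $\mathfrak p$ with $|a|_{\mathfrak p}=\#(O_K/\mathfrak p)^{-\mathrm{ord}_{\mathfrak p}(a)}$; for $v=\sigma\in K(\mathbb C)$, $K_v=K\otimes^{\sigma}_K\mathbb C\cong\mathbb C$. $X_v=X\times_{\mathrm{Spec} K}\mathrm{Spec} K_v$; $X_v^{\mathrm{an}}$ is $X_\sigma(\mathbb C)$ with the analytic topology if $v=\sigma$, and the Berkovich analytification if $v=\mathfrak p$. $X(\mathbb C)=\coprod_\sigma X_\sigma(\mathbb C)$; complex conjugation induces an involution $F_\infty$ of $X(\mathbb C)$ (exchanging $X_\sigma(\mathbb C)$ and $X_{\bar\sigma}(\mathbb C)$). $\mathrm{Div}_{\mathbb R}(X)=\mathrm{Div}(X)\otimes_{\mathbb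 Z}\mathbb R$ ($\mathrm{Div}(X)$ = Cartier divisors), $\mathrm{Rat}(X)^\times_{\mathbb R}=\mathrm{Rat}(X)^\times\otimes_{\mathbb Z}\mathbb R$, and $\varphi\mapsto(\varphi)$ is extended $\mathbb R$-linearly. $D\ge 0$ means that $D$ is a combination of effective Cartier divisors with non-negative real coefficients. A $D$-Green function of $C^0$-type on $X_v^{\mathrm{an}}$ is a real function $g_v$ defined off $\mathrm{Supp}(D)$ such that, for every local equation $\phi$ of $D$, $g_v+\log|\phi|^2$ extends to a continuous function locally. If $\mathscr X$ is a model of $X$ (projective flat integral scheme with generic fibre $X$) over a non-empty open $U\subseteq\mathrm{Spec}(O_K)$ and $\mathscr D$ an $\mathbb R$-Cartier divisor on $\mathscr X$ restricting to $D$, the model Green function at $\mathfrak p\in U$ is $x\mapsto-\log|\phi|_x^2$, with $\phi$ a local equation of $\mathscr D$ at the reduction of $x$. An adelic arithmetic $\mathbb R$-Cartier divisor (of $C^0$-type) is a pair $\overline D=(D,g)$, $g=(g_v)_{v\in M_K\cup K(\mathbb C)}$, also written $g=\sum_vg_v[v]$, with $g_v$ a $D$-Green function of $C^0$-type on $X_v^{\mathrm{an}}$, such that for all but finitely many $\mathfrak p$ the $g_{\mathfrak p}$ come from one model $(\mathscr X,\mathscr D)$ over some $U$, and $(g_\sigma)_\sigma$ is $F_\infty$-invariant. $\overline D\ge0$ (effective) means $D\ge0$ and $g_v\ge0$ for all $v$. For $\phi\in\mathrm{Rat}(X)^\times_{\mathbb R}$, $\widehat{(\phi)}=((\phi),(-\log|\phi|_v^2)_v)$.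 $\overline D$ has the Dirichlet property if $\overline D+\widehat{(\phi)}\ge0$ for some $\phi\in\mathrm{Rat}(X)^\times_{\mathbb R}$. If $D+(s)\ge0$, $|s|_{g_v}:=|s|_v\exp(-g_v/2)$, a continuous function on $X_v^{\mathrm{an}}$. Asymptotic maximal slope: let $\pi:X\to\mathrm{Spec} K$ be the structural morphism. An adelic arithmetic $\mathbb R$-Cartier divisor on $\mathrm{Spec} K$ is a finite formal sum $\zeta=\sum_v\zeta_v[v]$ with $\zeta_v\in\mathbb R$ and $\zeta_\sigma=\zeta_{\bar\sigma}$; $\widehat{\deg}(\zeta)=\frac12\sum_v\zeta_v$. For $D$ big and any $\zeta$ with $\widehat{\deg}(\zeta)=1$, $$\widehat\mu_{\max}^{\mathrm{asy}}(\overline D)=\sup\{t\in\mathbb R:\overline D-t\pi^*(\zeta)\text{ has the Dirichlet property}\},$$ a real number independent of the choice of $\zeta$. For $f_v\in C^0(X_v^{\mathrm{an}})$, $\overline O(f_v)$ is $(0,f_v[v])$ if $v\in M_K$ and $(0,\frac12f_v[v]+\frac12F_\infty^*(f_v)[\bar v])$ if $v\in K(\mathbb C)$. For $D$ big and non-negative $f_v\in C^0(X_v^{\mathrm{an}})$, $$\Psi_{\overline D,v}^{\widehat\mu_{\max}^{\mathrm{asy}}}(f_v)=\limsup_{\epsilon\to0+}\frac{\widehat\mu_{\max}^{\mathrm{asy}}(\overline D+\epsilon\overline O(f_v))-\widehat\mu_{\max}^{\mathrm{asy}}(\overline D)}{\epsilon}\in[0,+\infty].$$ The support of such a functional $\Psi$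 is the set of $x\in X_v^{\mathrm{an}}$ such that $\Psi(f_v)>0$ for every non-negative continuous $f_v$ on $X_v^{\mathrm{an}}$ with $f_v(x)>0$. *)

theory Defs
  imports
    "HOL-Analysis.Analysis"
    "HOL-Algebra.QuotRing"
    "HOL-Algebra.Ideal_Product"
    "HOL-Algebra.Generated_Rings"
    "HOL-Computational_Algebra.Computational_Algebra"
    "HOL-Library.Poly_Mapping"
    "HOL-Library.Function_Algebras"
begin

section \<open>Integral schemes as sets of local rings\<close>

text \<open>
  The number field is the whole type \<open>'k\<close>, the function field \<open>Rat(X)\<close> is the whole type \<open>'f\<close>,
  and \<open>\<iota> :: 'k \<Rightarrow> 'f\<close> is the structural embedding.  An integral separated scheme of finite type
  with function field \<open>'f\<close> is encoded, following Chevalley, by the set of its local rings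
  \<open>O\<^sub>X\<^sub>,\<^sub>P \<subseteq> 'f\<close>; a point \<open>P\<close> \<^emph>\<open>is\<close> its local ring.  The generic point is \<open>UNIV\<close>, a point \<open>Q\<close> is a
  specialization of \<open>P\<close> iff \<open>Q \<subseteq> P\<close>, and \<open>O\<^sub>X(U)\<close> is the intersection of the members of \<open>U\<close>.
\<close>

definition ring_on :: "'a::comm_ring_1 set \<Rightarrow> 'a ring" where
  "ring_on S = \<lparr>carrier = S, mult = (*), one = 1, zero = 0, add = (+)\<rparr>"

definition is_ring_hom :: "('a::comm_ring_1 \<Rightarrow> 'b::comm_ring_1) \<Rightarrow> bool" where
  "is_ring_hom h \<longleftrightarrow> h \<in> ring_hom (ring_on UNIV) (ring_on UNIV)"

definition localization :: "'a::field set \<Rightarrow> 'a set \<Rightarrow> 'a set" where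
  "localization A q = {a / b | a b. a \<in> A \<and> b \<in> A - q}"

definition spec_points :: "'a::field set \<Rightarrow> 'a set set" where
  "spec_points A = {localization A q | q. primeideal q (ring_on A)}"

text \<open>Zariski topology: the domains of definition of rational functions generate the opens, since
  \<open>Spec A = {P \<in> X. A \<subseteq> P}\<close> for an affine open \<open>Spec A\<close> of a separated \<open>X\<close>, \<open>A\<close> is finitely
  generated, and \<open>D(a) = {P \<in> Spec A. 1 / a \<in> P}\<close>.\<close>

definition zariski :: "'f set set \<Rightarrow> 'f set topology" where
  "zariski X = topology_generated_by {{P \<in> X. f \<in> P} | f. True}"

text \<open>\<open>proj_chart \<iota> R xs i\<close> is the coordinate ring \<open>R[x\<^sub>j/x\<^sub>i : j]\<close> of the \<open>i\<close>-th standard affine chart of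
  the closed integral subscheme of projective space over \<open>R\<close> with generic point \<open>(x\<^sub>0 : ... : x\<^sub>n)\<close>.
  Every integral closed subscheme arises in this way; charts with \<open>x\<^sub>i = 0\<close> are empty.\<close>

definition proj_chart :: "('k::field \<Rightarrow> 'f::field) \<Rightarrow> 'k set \<Rightarrow> 'f list \<Rightarrow> nat \<Rightarrow> 'f set" where
  "proj_chart \<iota> R xs i = generate_ring (ring_on UNIV) (\<iota> ` R \<union> {y / xs ! i | y. y \<in> set xs})"

text \<open>The clause \<open>UNIV \<in> X\<close> says that the function field of \<open>X\<close> is all of \<open>'f\<close>.  Since \<open>R \<subseteq> 'f\<close>,
  flatness over a Dedekind ring \<open>R\<close> is automatic.\<close>

definition integral_projective :: "('k::field \<Rightarrow> 'f::field) \<Rightarrow> 'k set \<Rightarrow> 'f set set \<Rightarrow> bool" where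
  "integral_projective \<iota> R X \<longleftrightarrow> UNIV \<in> X \<and>
     (\<exists>xs. X = (\<Union>i \<in> {i. i < length xs \<and> xs ! i \<noteq> 0}. spec_points (proj_chart \<iota> R xs i)))"

definition krull_dim :: "'f set set \<Rightarrow> nat" where
  "krull_dim X = Sup {n. \<exists>c :: nat \<Rightarrow> 'f set. (\<forall>i\<le>n. c i \<in> X) \<and> (\<forall>i<n. c (Suc i) \<subset> c i)}"


section \<open>Scalar extension\<close>

text \<open>Elements of \<open>A \<otimes>\<^sub>K L\<close>, for a \<open>K\<close>-subalgebra \<open>A\<close> of \<open>'f\<close> and a \<open>K\<close>-algebra \<open>\<tau> : K \<rightarrow> L\<close> with \<open>L\<close> a
  subset of the type \<open>'l\<close>, are represented by formal sums of tensors \<open>a \<otimes> c\<close> (encoded as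
  \<^term>\<open>Poly_Mapping.single a c\<close>) modulo \<open>base_change_null\<close>.\<close>

definition base_change_carrier :: "'f set \<Rightarrow> 'l set \<Rightarrow> ('f \<Rightarrow>\<^sub>0 'l::comm_ring_1) set" where
  "base_change_carrier A L = {u. Poly_Mapping.keys u \<subseteq> A \<and> range (Poly_Mapping.lookup u) \<subseteq> L}"

inductive_set base_change_null ::
  "('k::field \<Rightarrow> 'f::field) \<Rightarrow> ('k \<Rightarrow> 'l) \<Rightarrow> 'f set \<Rightarrow> 'l set \<Rightarrow> ('f \<Rightarrow>\<^sub>0 'l::comm_ring_1) set"
  for \<iota> \<tau> A L where
  zero: "0 \<in> base_change_null \<iota> \<tau> A L"
| plus: "u \<in> base_change_null \<iota> \<tau> A L \<Longrightarrow> w \<in> base_change_null \<iota> \<tau> A L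
    \<Longrightarrow> u + w \<in> base_change_null \<iota> \<tau> A L"
| additive: "a \<in> A \<Longrightarrow> b \<in> A \<Longrightarrow> c \<in> L \<Longrightarrow>
    Poly_Mapping.single (a + b) c - Poly_Mapping.single a c - Poly_Mapping.single b c
      \<in> base_change_null \<iota> \<tau> A L"
| balanced: "a \<in> A \<Longrightarrow> c \<in> L \<Longrightarrow>
    Poly_Mapping.single (\<iota> k * a) c - Poly_Mapping.single a (\<tau> k * c) \<in> base_change_null \<iota> \<tau> A L"

definition base_change_mult ::
  "('f::field \<Rightarrow>\<^sub>0 'l::comm_ring_1) \<Rightarrow> ('f \<Rightarrow>\<^sub>0 'l) \<Rightarrow> ('f \<Rightarrow>\<^sub>0 'l)" where
  "base_change_mult u w = (\<Sum>a \<in> Poly_Mapping.keys u. \<Sum>b \<in> Poly_Mapping.keys w.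
     Poly_Mapping.single (a * b) (Poly_Mapping.lookup u a * Poly_Mapping.lookup w b))"

definition base_change_domain :: "('k::field \<Rightarrow> 'f::field) \<Rightarrow> ('k \<Rightarrow> 'l::comm_ring_1) \<Rightarrow> 'f set \<Rightarrow> bool" where
  "base_change_domain \<iota> \<tau> A \<longleftrightarrow>
     Poly_Mapping.single 1 1 \<notin> base_change_null \<iota> \<tau> A UNIV \<and>
     (\<forall>u \<in> base_change_carrier A UNIV. \<forall>w \<in> base_change_carrier A UNIV.
        base_change_mult u w \<in> base_change_null \<iota> \<tau> A UNIV \<longrightarrow>
        u \<in> base_change_null \<iota> \<tau> A UNIV \<or> w \<in> base_change_null \<iota> \<tau> A UNIV)"

text \<open>By flat base change \<open>O(U) \<otimes>\<^sub>K \<complex>\<close> is the ring of sections of \<open>X\<^sub>\<sigma> = X \<times>\<^sup>\<sigma> Spec \<complex>\<close> over \<open>U\<^sub>\<sigma>\<close>, so the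
  following says that each \<open>X\<^sub>\<sigma>\<close> is integral; integrality over one algebraically closed extension
  of \<open>K\<close> is integrality over all extensions.\<close>

definition geometrically_integral :: "('k::field \<Rightarrow> 'f::field) \<Rightarrow> 'f set set \<Rightarrow> bool" where
  "geometrically_integral \<iota> X \<longleftrightarrow>
     (\<forall>\<sigma> :: 'k \<Rightarrow> complex. is_ring_hom \<sigma> \<longrightarrow>
        (\<forall>U. openin (zariski X) U \<and> U \<noteq> {} \<longrightarrow> base_change_domain \<iota> \<sigma> (\<Inter>U)))"


section \<open>Number fields and their places\<close>

definition number_field :: "'k::field_char_0 itself \<Rightarrow> bool" where
  "number_field _ \<longleftrightarrow>
     (\<exists>B :: 'k set. finite B \<and> (\<forall>x. \<exists>c :: 'k \<Rightarrow> rat. x = (\<Sum>b\<in>B. of_rat (c b) * b)))"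

definition ring_of_integers :: "'k::field_char_0 set" where
  "ring_of_integers = {a. algebraic_int a}"

definition max_ideals :: "'k::field_char_0 set set" where
  "max_ideals = {p. maximalideal p (ring_on ring_of_integers)}"

definition residue_card :: "'k::field_char_0 set \<Rightarrow> nat" where
  "residue_card p = card (carrier (ring_on ring_of_integers Quot p))"

definition ord_integer :: "'k::field_char_0 set \<Rightarrow> 'k \<Rightarrow> nat" where
  "ord_integer p a = (GREATEST n. a \<in> p [^]\<^bsub>ideals_set (ring_on ring_of_integers)\<^esub> n)"

definition ord_at :: "'k::field_char_0 set \<Rightarrow> 'k \<Rightarrow> int" where
  "ord_at p a = (THE n. \<exists>b c. b \<in> ring_of_integers - {0} \<and> c \<in> ring_of_integers - {0} \<and>
     a = b / c \<and> n = int (ord_integer p b) - int (ord_integer p c))"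

definition padic_abs :: "'k::field_char_0 set \<Rightarrow> 'k \<Rightarrow> real" where
  "padic_abs p a = (if a = 0 then 0 else real (residue_card p) powr (- real_of_int (ord_at p a)))"

text \<open>Elements of the completion \<open>K\<^sub>p\<close> are represented by Cauchy sequences, with pointwise operations;
  null sequences are the elements of absolute value 0.\<close>

definition padic_cauchy :: "'k::field_char_0 set \<Rightarrow> (nat \<Rightarrow> 'k) set" where
  "padic_cauchy p = {c. \<forall>e>0. \<exists>M. \<forall>m\<ge>M. \<forall>n\<ge>M. padic_abs p (c m - c n) < e}"

definition completion_abs :: "'k::field_char_0 set \<Rightarrow> (nat \<Rightarrow> 'k) \<Rightarrow> real" where
  "completion_abs p c = lim (\<lambda>n. padic_abs p (c n))"

datatype 'k place = Finite_place "'k set" | Infinite_place "'k \<Rightarrow> complex"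

definition places :: "'k::field_char_0 place set" where
  "places = Finite_place ` max_ideals \<union> Infinite_place ` {\<sigma>. is_ring_hom \<sigma>}"

fun conj_place :: "'k place \<Rightarrow> 'k place" where
  "conj_place (Finite_place p) = Finite_place p"
| "conj_place (Infinite_place \<sigma>) = Infinite_place (\<lambda>a. cnj (\<sigma> a))"


section \<open>Tensor products with the reals, and \<open>\<real>\<close>-Cartier divisors\<close>

text \<open>For a commutative group \<open>G\<close>, elements of \<open>G \<otimes>\<^sub>\<int> \<real>\<close> are represented by finite formal real
  combinations of elements of \<open>G\<close>; two of them are equal in \<open>G \<otimes>\<^sub>\<int> \<real>\<close> iff they are related by
  \<open>tensor_eq G\<close>.  All notions below respect this relation.\<close>

inductive_set tensor_null :: "('a, 'b) monoid_scheme \<Rightarrow> ('a \<Rightarrow>\<^sub>0 real) set" for G where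
  zero: "0 \<in> tensor_null G"
| plus: "u \<in> tensor_null G \<Longrightarrow> w \<in> tensor_null G \<Longrightarrow> u + w \<in> tensor_null G"
| relation: "a \<in> carrier G \<Longrightarrow> b \<in> carrier G \<Longrightarrow>
    Poly_Mapping.single (a \<otimes>\<^bsub>G\<^esub> b) r - Poly_Mapping.single a r - Poly_Mapping.single b r
      \<in> tensor_null G"

definition tensor_eq :: "('a, 'b) monoid_scheme \<Rightarrow> ('a \<Rightarrow>\<^sub>0 real) \<Rightarrow> ('a \<Rightarrow>\<^sub>0 real) \<Rightarrow> bool" where
  "tensor_eq G u w \<longleftrightarrow> u - w \<in> tensor_null G"

definition linear_extend :: "('a \<Rightarrow> 'b) \<Rightarrow> ('a \<Rightarrow>\<^sub>0 real) \<Rightarrow> ('b \<Rightarrow>\<^sub>0 real)" where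
  "linear_extend h u =
     (\<Sum>a \<in> Poly_Mapping.keys u. Poly_Mapping.single (h a) (Poly_Mapping.lookup u a))"

text \<open>A Cartier divisor is a global section of the sheaf of cosets \<open>'f\<^sup>\<times> / O\<^sub>X\<^sup>\<times>\<close>, given by its germs: it
  sends \<open>P\<close> to the coset \<open>f O\<^sub>P\<^sup>\<times>\<close> of its local equations at \<open>P\<close> (and is \<open>{}\<close> off \<open>X\<close>).\<close>

type_synonym 'f divisor = "'f set \<Rightarrow> 'f set"

definition local_units :: "'f::field set \<Rightarrow> 'f set" where
  "local_units P = Units (ring_on P)"

definition principal_divisor :: "'f::field set set \<Rightarrow> 'f \<Rightarrow> 'f divisor" where
  "principal_divisor X f = (\<lambda>P. if P \<in> X then {f * u | u. u \<in> local_units P} else {})"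

definition cartier_divisors :: "'f::field set set \<Rightarrow> 'f divisor set" where
  "cartier_divisors X = {D. (\<forall>P. P \<notin> X \<longrightarrow> D P = {}) \<and>
     (\<forall>P\<in>X. \<exists>U f. openin (zariski X) U \<and> P \<in> U \<and> f \<noteq> 0 \<and>
        (\<forall>Q\<in>U. D Q = principal_divisor X f Q))}"

definition divisor_group :: "'f::field set set \<Rightarrow> 'f divisor monoid" where
  "divisor_group X = \<lparr>carrier = cartier_divisors X,
     mult = (\<lambda>D E P. {a * b | a b. a \<in> D P \<and> b \<in> E P}),
     one = principal_divisor X 1\<rparr>"

definition effective_cartier :: "'f::field set set \<Rightarrow> 'f divisor \<Rightarrow> bool" where
  "effective_cartier X D \<longleftrightarrow> D \<in> cartier_divisors X \<and> (\<forall>P\<in>X. D P \<subseteq> P)"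

definition rdivisors :: "'f::field set set \<Rightarrow> ('f divisor \<Rightarrow>\<^sub>0 real) set" where
  "rdivisors X = {D. Poly_Mapping.keys D \<subseteq> cartier_divisors X}"

definition rdivisor_nonneg :: "'f::field set set \<Rightarrow> ('f divisor \<Rightarrow>\<^sub>0 real) \<Rightarrow> bool" where
  "rdivisor_nonneg X D \<longleftrightarrow> (\<exists>E. tensor_eq (divisor_group X) D E \<and>
     (\<forall>C \<in> Poly_Mapping.keys E. effective_cartier X C \<and> Poly_Mapping.lookup E C \<ge> 0))"

text \<open>\<open>Rat(X)\<^sup>\<times> \<otimes> \<real>\<close>, the \<open>\<real>\<close>-linear extension of \<open>\<phi> \<mapsto> (\<phi>)\<close>, and restriction of \<open>\<real>\<close>-divisors.\<close>

definition rrational :: "('f::field \<Rightarrow>\<^sub>0 real) set" where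
  "rrational = {\<phi>. 0 \<notin> Poly_Mapping.keys \<phi>}"

definition rprincipal :: "'f::field set set \<Rightarrow> ('f \<Rightarrow>\<^sub>0 real) \<Rightarrow> ('f divisor \<Rightarrow>\<^sub>0 real)" where
  "rprincipal X \<phi> = linear_extend (principal_divisor X) \<phi>"

definition rrestrict :: "'f set set \<Rightarrow> ('f divisor \<Rightarrow>\<^sub>0 real) \<Rightarrow> ('f divisor \<Rightarrow>\<^sub>0 real)" where
  "rrestrict U D = linear_extend (\<lambda>C P. if P \<in> U then C P else {}) D"

text \<open>\<open>\<phi> \<in> Rat(X)\<^sup>\<times> \<otimes> \<real>\<close> is a local equation of \<open>D\<close> on the open set \<open>U\<close>: \<open>D|\<^sub>U = (\<phi>)\<close> in \<open>Div(U) \<otimes> \<real>\<close>.\<close>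

definition local_equation ::
  "'f::field set set \<Rightarrow> ('f divisor \<Rightarrow>\<^sub>0 real) \<Rightarrow> ('f \<Rightarrow>\<^sub>0 real) \<Rightarrow> bool" where
  "local_equation U D \<phi> \<longleftrightarrow>
     \<phi> \<in> rrational \<and> tensor_eq (divisor_group U) (rrestrict U D) (rprincipal U \<phi>)"

definition rsupport :: "'f::field set set \<Rightarrow> ('f divisor \<Rightarrow>\<^sub>0 real) \<Rightarrow> 'f set set" where
  "rsupport X D = {P \<in> X. \<not> (\<exists>U. openin (zariski X) U \<and> P \<in> U \<and> local_equation U D 0)}"

text \<open>Bigness: \<open>h\<^sup>0(m C)\<close> grows like \<open>m\<^sup>d\<close> for a big Cartier divisor \<open>C\<close>, and an \<open>\<real>\<close>-Cartier divisor is
  big if it is a positive real combination of big Cartier divisors.\<close>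

definition global_sections :: "'f::field set set \<Rightarrow> 'f divisor \<Rightarrow> 'f set" where
  "global_sections X C = {f. \<forall>P\<in>X. \<forall>e \<in> C P. f * e \<in> P}"

definition big_cartier :: "('k::field \<Rightarrow> 'f::field) \<Rightarrow> 'f set set \<Rightarrow> 'f divisor \<Rightarrow> bool" where
  "big_cartier \<iota> X C \<longleftrightarrow> C \<in> cartier_divisors X \<and>
     Limsup sequentially (\<lambda>m. ereal (real (vector_space.dim (\<lambda>a f. \<iota> a * f)
        (global_sections X (C [^]\<^bsub>divisor_group X\<^esub> m))) / real m ^ krull_dim X)) > 0"

definition big_rdivisor :: "('k::field \<Rightarrow> 'f::field) \<Rightarrow> 'f set set \<Rightarrow> ('f divisor \<Rightarrow>\<^sub>0 real) \<Rightarrow> bool" where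
  "big_rdivisor \<iota> X D \<longleftrightarrow> (\<exists>E. tensor_eq (divisor_group X) D E \<and> Poly_Mapping.keys E \<noteq> {} \<and>
     (\<forall>C \<in> Poly_Mapping.keys E. big_cartier \<iota> X C \<and> Poly_Mapping.lookup E C > 0))"


section \<open>Analytifications\<close>

text \<open>
  For \<open>v = p\<close>, a point of the Berkovich space over a scheme point \<open>P\<close> of \<open>X\<close> is a point of \<open>X\<^sub>v\<close> over \<open>P\<close>
  with an absolute value on its residue field extending that of \<open>K\<^sub>p\<close>, that is, a
  multiplicative seminorm on \<open>O\<^sub>P \<otimes>\<^sub>K K\<^sub>p\<close> extending the absolute value of \<open>K\<^sub>p\<close> whose kernel meets \<open>O\<^sub>P\<close>
  in the maximal ideal.  For \<open>v = \<sigma>\<close>, a point of \<open>X\<^sub>\<sigma>(\<complex>)\<close> is a morphism \<open>Spec \<complex> \<rightarrow> X\<close> over \<open>\<sigma>\<close>, that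
  is, a point \<open>P\<close> and a local homomorphism \<open>O\<^sub>P \<rightarrow> \<complex>\<close> extending \<open>\<sigma>\<close>.  All these maps are set to 0
  outside their domains, so that equality of points is equality of terms.
\<close>

declare [[typedef_overloaded]]

datatype ('k, 'f) an_point =
    Berkovich_point (centre: "'f set") (seminorm: "('f \<Rightarrow>\<^sub>0 (nat \<Rightarrow> 'k)) \<Rightarrow> real")
  | Complex_point (centre: "'f set") (evaluation: "'f \<Rightarrow> complex")

definition berkovich_seminorm ::
  "('k::field_char_0 \<Rightarrow> 'f::field) \<Rightarrow> 'k set \<Rightarrow> 'f set \<Rightarrow> (('f \<Rightarrow>\<^sub>0 (nat \<Rightarrow> 'k)) \<Rightarrow> real) \<Rightarrow> bool" where
  "berkovich_seminorm \<iota> p P N \<longleftrightarrow>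
     (let T = base_change_carrier P (padic_cauchy p) in
       (\<forall>u. u \<notin> T \<longrightarrow> N u = 0) \<and>
       (\<forall>u\<in>T. 0 \<le> N u) \<and>
       (\<forall>u\<in>T. \<forall>w\<in>T. u - w \<in> base_change_null \<iota> (\<lambda>a _. a) P (padic_cauchy p) \<longrightarrow> N u = N w) \<and>
       (\<forall>u\<in>T. \<forall>w\<in>T. N (u + w) \<le> N u + N w) \<and>
       (\<forall>u\<in>T. \<forall>w\<in>T. N (base_change_mult u w) = N u * N w) \<and>
       (\<forall>c \<in> padic_cauchy p. N (Poly_Mapping.single 1 c) = completion_abs p c) \<and>
       (\<forall>f\<in>P. N (Poly_Mapping.single f 1) = 0 \<longleftrightarrow> f \<notin> local_units P))"

definition complex_evaluation ::
  "('k::field \<Rightarrow> 'f::field) \<Rightarrow> ('k \<Rightarrow> complex) \<Rightarrow> 'f set \<Rightarrow> ('f \<Rightarrow> complex) \<Rightarrow> bool" where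
  "complex_evaluation \<iota> \<sigma> P e \<longleftrightarrow>
     (\<forall>f. f \<notin> P \<longrightarrow> e f = 0) \<and>
     e \<in> ring_hom (ring_on P) (ring_on UNIV) \<and>
     (\<forall>a. e (\<iota> a) = \<sigma> a) \<and>
     (\<forall>f\<in>P. e f = 0 \<longleftrightarrow> f \<notin> local_units P)"

fun an_points ::
  "('k::field_char_0 \<Rightarrow> 'f::field) \<Rightarrow> 'f set set \<Rightarrow> 'k place \<Rightarrow> ('k, 'f) an_point set" where
  "an_points \<iota> X (Finite_place p) = {Berkovich_point P N | P N. P \<in> X \<and> berkovich_seminorm \<iota> p P N}"
| "an_points \<iota> X (Infinite_place \<sigma>) = {Complex_point P e | P e. P \<in> X \<and> complex_evaluation \<iota> \<sigma> P e}"

text \<open>The coarsest topology for which the points over any Zariski open \<open>U\<close> form an open set, on which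
  \<open>|h|\<close> (\<open>h \<in> O(U) \<otimes>\<^sub>K K\<^sub>p\<close>), resp. \<open>f\<close> (\<open>f \<in> O(U)\<close>), is continuous.\<close>

fun an_topology ::
  "('k::field_char_0 \<Rightarrow> 'f::field) \<Rightarrow> 'f set set \<Rightarrow> 'k place \<Rightarrow> ('k, 'f) an_point topology" where
  "an_topology \<iota> X (Finite_place p) = topology_generated_by
     {{x \<in> an_points \<iota> X (Finite_place p).
         h \<in> base_change_carrier (centre x) (padic_cauchy p) \<and> seminorm x h \<in> V} | h V. open V}"
| "an_topology \<iota> X (Infinite_place \<sigma>) = topology_generated_by
     {{x \<in> an_points \<iota> X (Infinite_place \<sigma>). f \<in> centre x \<and> evaluation x f \<in> V} | f V. open V}"

fun abs_at :: "('k::field_char_0, 'f::field) an_point \<Rightarrow> 'f \<Rightarrow> real" where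
  "abs_at (Berkovich_point P N) f = N (Poly_Mapping.single f 1)"
| "abs_at (Complex_point P e) f = cmod (e f)"

text \<open>\<open>log_abs x \<phi> = log |\<phi>|\<^sub>x\<close>; meaningful if the rational functions occurring in \<open>\<phi>\<close> are units at the
  centre of \<open>x\<close>.\<close>

definition units_at :: "('f::field \<Rightarrow>\<^sub>0 real) \<Rightarrow> 'f set \<Rightarrow> bool" where
  "units_at \<phi> P \<longleftrightarrow> Poly_Mapping.keys \<phi> \<subseteq> local_units P"

definition log_abs :: "('k::field_char_0, 'f::field) an_point \<Rightarrow> ('f \<Rightarrow>\<^sub>0 real) \<Rightarrow> real" where
  "log_abs x \<phi> = (\<Sum>f \<in> Poly_Mapping.keys \<phi>. Poly_Mapping.lookup \<phi> f * ln (abs_at x f))"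

fun conj_point :: "('k, 'f) an_point \<Rightarrow> ('k, 'f) an_point" where
  "conj_point (Berkovich_point P N) = Berkovich_point P N"
| "conj_point (Complex_point P e) = Complex_point P (\<lambda>f. cnj (e f))"


section \<open>Adelic arithmetic \<open>\<real>\<close>-Cartier divisors\<close>

text \<open>Green functions are total functions on analytic points; their values over the support of the
  divisor are irrelevant.  A \<open>D\<close>-Green function is thus known on the (dense) part of the
  analytification over any non-empty Zariski open set.\<close>

type_synonym ('k, 'f) green_family = "'k place \<Rightarrow> ('k, 'f) an_point \<Rightarrow> real"
type_synonym ('k, 'f) adelic_pair = "('f divisor \<Rightarrow>\<^sub>0 real) \<times> ('k, 'f) green_family"

definition green_function ::
  "('k::field_char_0 \<Rightarrow> 'f::field) \<Rightarrow> 'f set set \<Rightarrow> 'k place \<Rightarrow> ('f divisor \<Rightarrow>\<^sub>0 real) \<Rightarrow>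
   (('k, 'f) an_point \<Rightarrow> real) \<Rightarrow> bool" where
  "green_function \<iota> X v D g \<longleftrightarrow>
     (\<forall>U \<phi>. openin (zariski X) U \<and> local_equation U D \<phi> \<longrightarrow>
        (\<forall>x \<in> an_points \<iota> X v. centre x \<in> U \<longrightarrow>
           (\<exists>W h. openin (an_topology \<iota> X v) W \<and> x \<in> W \<and> (\<forall>y\<in>W. centre y \<in> U) \<and>
              continuous_map (subtopology (an_topology \<iota> X v) W) euclideanreal h \<and>
              (\<forall>y\<in>W. centre y \<notin> rsupport X D \<and> units_at \<phi> (centre y) \<longrightarrow>
                 h y = g y + 2 * log_abs y \<phi>))))"

text \<open>\<open>O\<^sub>K\<^sub>,\<^sub>U\<close>, for a set \<open>U\<close> of maximal ideals with finite complement.  (The non-empty opens of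
  \<open>Spec O\<^sub>K\<close> are affine and consist of such a \<open>U\<close> and the generic point.)\<close>

definition integers_over :: "'k::field_char_0 set set \<Rightarrow> 'k set" where
  "integers_over U = (\<Inter>p\<in>U. localization ring_of_integers p)"

text \<open>The point \<open>Q\<close> of the model \<open>Y\<close> is the reduction of \<open>x\<close>: \<open>O\<^sub>Q\<close> is dominated by the valuation ring of
  the absolute value on the residue field at the centre of \<open>x\<close>.\<close>

definition is_reduction :: "'f::field set set \<Rightarrow> ('k::field_char_0, 'f) an_point \<Rightarrow> 'f set \<Rightarrow> bool" where
  "is_reduction Y x Q \<longleftrightarrow> Q \<in> Y \<and> Q \<subseteq> centre x \<and>
     (\<forall>f\<in>Q. abs_at x f \<le> 1) \<and> (\<forall>f\<in>Q. abs_at x f < 1 \<longleftrightarrow> f \<notin> local_units Q)"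

definition model_green ::
  "('k::field_char_0 \<Rightarrow> 'f::field) \<Rightarrow> 'f set set \<Rightarrow> 'f set set \<Rightarrow> ('f divisor \<Rightarrow>\<^sub>0 real) \<Rightarrow> 'k set \<Rightarrow>
   ('f divisor \<Rightarrow>\<^sub>0 real) \<Rightarrow> (('k, 'f) an_point \<Rightarrow> real) \<Rightarrow> bool" where
  "model_green \<iota> X Y E p D g \<longleftrightarrow>
     (\<forall>x \<in> an_points \<iota> X (Finite_place p). centre x \<notin> rsupport X D \<longrightarrow>
        (\<exists>Q W \<phi>. is_reduction Y x Q \<and> openin (zariski Y) W \<and> Q \<in> W \<and> local_equation W E \<phi> \<and>
           units_at \<phi> (centre x) \<and> g x = - 2 * log_abs x \<phi>))"

definition adelic_divisor ::
  "('k::field_char_0 \<Rightarrow> 'f::field) \<Rightarrow> 'f set set \<Rightarrow> ('k, 'f) adelic_pair \<Rightarrow> bool" where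
  "adelic_divisor \<iota> X Db \<longleftrightarrow> (case Db of (D, g) \<Rightarrow>
     D \<in> rdivisors X \<and>
     (\<forall>v\<in>places. green_function \<iota> X v D (g v)) \<and>
     (\<exists>U Y E. U \<subseteq> max_ideals \<and> finite (max_ideals - U) \<and>
        integral_projective \<iota> (integers_over U) Y \<and> {P \<in> Y. range \<iota> \<subseteq> P} = X \<and>
        E \<in> rdivisors Y \<and> tensor_eq (divisor_group X) (rrestrict X E) D \<and>
        finite {p \<in> max_ideals. \<not> (p \<in> U \<and> model_green \<iota> X Y E p D (g (Finite_place p)))}) \<and>
     (\<forall>\<sigma>. is_ring_hom \<sigma> \<longrightarrow> (\<forall>x \<in> an_points \<iota> X (Infinite_place \<sigma>). centre x \<notin> rsupport X D \<longrightarrow>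
        g (conj_place (Infinite_place \<sigma>)) (conj_point x) = g (Infinite_place \<sigma>) x)))"

text \<open>The Green functions in sums of adelic divisors are only determined after continuous extension
  from a dense open set.  Hence non-negativity is required over some non-empty Zariski open set;
  by continuity and density this is non-negativity wherever the Green function is defined.\<close>

definition adelic_nonneg ::
  "('k::field_char_0 \<Rightarrow> 'f::field) \<Rightarrow> 'f set set \<Rightarrow> ('k, 'f) adelic_pair \<Rightarrow> bool" where
  "adelic_nonneg \<iota> X Db \<longleftrightarrow> rdivisor_nonneg X (fst Db) \<and>
     (\<forall>v\<in>places. \<exists>U. openin (zariski X) U \<and> U \<noteq> {} \<and>
        (\<forall>x \<in> an_points \<iota> X v. centre x \<in> U \<longrightarrow> 0 \<le> snd Db v x))"

definition adelic_add ::
  "('k, 'f) adelic_pair \<Rightarrow> ('k, 'f) adelic_pair \<Rightarrow> ('k, 'f) adelic_pair" where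
  "adelic_add Db Eb = (fst Db + fst Eb, \<lambda>v x. snd Db v x + snd Eb v x)"

definition adelic_principal ::
  "'f::field set set \<Rightarrow> ('f \<Rightarrow>\<^sub>0 real) \<Rightarrow> ('k::field_char_0, 'f) adelic_pair" where
  "adelic_principal X \<phi> = (rprincipal X \<phi>, \<lambda>v x. - 2 * log_abs x \<phi>)"

definition dirichlet_property ::
  "('k::field_char_0 \<Rightarrow> 'f::field) \<Rightarrow> 'f set set \<Rightarrow> ('k, 'f) adelic_pair \<Rightarrow> bool" where
  "dirichlet_property \<iota> X Db \<longleftrightarrow>
     (\<exists>\<phi> \<in> rrational. adelic_nonneg \<iota> X (adelic_add Db (adelic_principal X \<phi>)))"

text \<open>\<open>|s|\<close> with respect to \<open>g\<^sub>v\<close> at \<open>x\<close>: the value at \<open>x\<close> of the continuous extension of \<open>|s|\<^sub>v exp (- g\<^sub>v / 2)\<close>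
  from the dense open set on which both factors are defined, written as a limit superior along
  this set (which may contain \<open>x\<close>).\<close>

definition section_norm ::
  "('k::field_char_0 \<Rightarrow> 'f::field) \<Rightarrow> 'f set set \<Rightarrow> 'k place \<Rightarrow> ('k, 'f) adelic_pair \<Rightarrow>
   ('f \<Rightarrow>\<^sub>0 real) \<Rightarrow> ('k, 'f) an_point \<Rightarrow> ereal" where
  "section_norm \<iota> X v Db s x =
     Limsup (inf_class.inf (nhdsin (an_topology \<iota> X v) x)
                 (principal {y. centre y \<notin> rsupport X (fst Db) \<and> units_at s (centre y)}))
       (\<lambda>y. ereal (exp (log_abs y s) * exp (- snd Db v y / 2)))"


section \<open>Asymptotic maximal slope and its directional derivative\<close>

definition adelic_base_divisor :: "('k::field_char_0 place \<Rightarrow> real) \<Rightarrow> bool" where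
  "adelic_base_divisor \<zeta> \<longleftrightarrow> finite {v. \<zeta> v \<noteq> 0} \<and> {v. \<zeta> v \<noteq> 0} \<subseteq> places \<and>
     (\<forall>v\<in>places. \<zeta> (conj_place v) = \<zeta> v)"

definition arakelov_degree :: "('k::field_char_0 place \<Rightarrow> real) \<Rightarrow> real" where
  "arakelov_degree \<zeta> = (\<Sum>v \<in> {v. \<zeta> v \<noteq> 0}. \<zeta> v) / 2"

definition pullback_base :: "('k place \<Rightarrow> real) \<Rightarrow> ('k, 'f) adelic_pair" where
  "pullback_base \<zeta> = (0, \<lambda>v x. \<zeta> v)"

definition mu_max_asy ::
  "('k::field_char_0 \<Rightarrow> 'f::field) \<Rightarrow> 'f set set \<Rightarrow> ('k place \<Rightarrow> real) \<Rightarrow> ('k, 'f) adelic_pair \<Rightarrow> ereal" where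
  "mu_max_asy \<iota> X \<zeta> Db =
     Sup (ereal ` {t. dirichlet_property \<iota> X (adelic_add Db (pullback_base (\<lambda>v. - t * \<zeta> v)))})"

definition O_bar ::
  "'k place \<Rightarrow> (('k, 'f) an_point \<Rightarrow> real) \<Rightarrow> ('k, 'f) adelic_pair" where
  "O_bar v f = (0, case v of
       Finite_place p \<Rightarrow> (\<lambda>w x. if w = v then f x else 0)
     | Infinite_place \<sigma> \<Rightarrow> (\<lambda>w x. (if w = v then f x / 2 else 0) +
                                 (if w = conj_place v then f (conj_point x) / 2 else 0)))"

definition Psi_mu ::
  "('k::field_char_0 \<Rightarrow> 'f::field) \<Rightarrow> 'f set set \<Rightarrow> ('k place \<Rightarrow> real) \<Rightarrow> ('k, 'f) adelic_pair \<Rightarrow>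
   'k place \<Rightarrow> (('k, 'f) an_point \<Rightarrow> real) \<Rightarrow> ereal" where
  "Psi_mu \<iota> X \<zeta> Db v f = Limsup (at_right 0) (\<lambda>\<epsilon>.
     (mu_max_asy \<iota> X \<zeta> (adelic_add Db (O_bar v (\<lambda>x. \<epsilon> * f x))) - mu_max_asy \<iota> X \<zeta> Db) / ereal \<epsilon>)"

definition functional_support ::
  "('k::field_char_0 \<Rightarrow> 'f::field) \<Rightarrow> 'f set set \<Rightarrow> 'k place \<Rightarrow>
   ((('k, 'f) an_point \<Rightarrow> real) \<Rightarrow> ereal) \<Rightarrow> ('k, 'f) an_point set" where
  "functional_support \<iota> X v \<Psi> = {x \<in> an_points \<iota> X v.
     \<forall>f. continuous_map (an_topology \<iota> X v) euclideanreal f \<and>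
         (\<forall>y \<in> an_points \<iota> X v. 0 \<le> f y) \<and> 0 < f x \<longrightarrow> 0 < \<Psi> f}"

end

theory Submission
  imports Defs
begin

text \<open>
  Let \<open>a = g\<^sub>v - log |s|\<^sup>2\<close>, which is non-negative and positive at \<open>x\<close>.  If \<open>0 \<le> f \<le> a\<close>, then
  \<open>D + \<epsilon> O(f) \<le> (1 + \<epsilon>) D + \<epsilon> (s)\<close>, so the slope of \<open>D + \<epsilon> O(f)\<close> is at most \<open>1 + \<epsilon>\<close> times the
  slope \<open>0\<close> of \<open>D\<close>, and \<open>\<Psi>(f) \<le> 0\<close>.  A continuous such \<open>f\<close> with \<open>f(x) > 0\<close> is a small bump function
  at \<open>x\<close>; it exists because the analytification of a projective scheme is completely regular.
\<close>

section \<open>Local rings\<close>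

text \<open>The function \<open>a\<close> is controlled only off the support of D + (s): over the
  support the Green functions take arbitrary values, and \<open>a\<close> may tend to infinity
  there. Two devices deal with this. Inequalities are claimed only over some non-empty Zariski open
  set, which is all that \<open>adelic_nonneg\<close> asks for, and finitely many such sets always
  share the generic point \<open>UNIV\<close>. Moreover the norm of s at x is a limit superior, so a
  value below 1 gives one lower bound \<open>\<delta>\<close> > 0 for \<open>a\<close> on a whole
  neighbourhood of x, off the support; the bump function is truncated at \<open>\<delta>\<close>.
  The factor 1 + \<epsilon> can be divided out because sections have real exponents. For slope mu
  the argument bounds the derivative by mu; the normalisation mu = 0 turns this into non-positivity.
  Complete regularity is the laborious step, because the topology is generated by functions that
  live on Zariski open subsets only. A bump function built from them must be extended by zero, and
  the homogeneous coordinates supply the globally continuous functions that cut it off.\<close>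

lemma cring_ring_on_UNIV: "cring (ring_on (UNIV :: 'a::comm_ring_1 set))"
proof (intro cringI abelian_groupI comm_monoidI)
  show "\<exists>y\<in>carrier (ring_on UNIV). y \<oplus>\<^bsub>ring_on UNIV\<^esub> x = \<zero>\<^bsub>ring_on UNIV\<^esub>" for x :: 'a
    by (auto simp: ring_on_def intro: exI[of _ "- x"])
qed (auto simp: ring_on_def algebra_simps)

lemma a_inv_ring_on_UNIV: "\<ominus>\<^bsub>ring_on UNIV\<^esub> x = - (x :: 'a::comm_ring_1)"
proof -
  interpret cring "ring_on (UNIV :: 'a set)"
    by (rule cring_ring_on_UNIV)
  show ?thesis
    by (rule minus_equality) (auto simp: ring_on_def)
qed

lemma subring_ring_on_iff:
  fixes S :: "'a::comm_ring_1 set"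
  shows "subring S (ring_on UNIV) \<longleftrightarrow>
    1 \<in> S \<and> (\<forall>a\<in>S. - a \<in> S) \<and> (\<forall>a\<in>S. \<forall>b\<in>S. a + b \<in> S) \<and> (\<forall>a\<in>S. \<forall>b\<in>S. a * b \<in> S)"
    (is "?L \<longleftrightarrow> ?R")
proof
  assume ?L
  then show ?R
    using subringE[of S "ring_on UNIV"] by (auto simp: a_inv_ring_on_UNIV) (auto simp: ring_on_def)
next
  interpret cring "ring_on (UNIV :: 'a set)"
    by (rule cring_ring_on_UNIV)
  assume ?R
  then show ?L
    by (intro subringI) (auto simp: a_inv_ring_on_UNIV, auto simp: ring_on_def)
qed

lemma subring_zero:
  fixes S :: "'a::comm_ring_1 set"
  assumes "subring S (ring_on UNIV)"
  shows "0 \<in> S"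
proof -
  have "1 + - 1 \<in> S"
    using assms unfolding subring_ring_on_iff by blast
  then show ?thesis by simp
qed

text \<open>The inverse of \<open>a\<close> within \<open>ring_on A\<close> solves a + y = 0 in the
  ambient ring, so it is \<open>- a\<close>. This recovers the closure properties of
  \<open>A\<close> from a prime ideal of \<open>ring_on A\<close>.\<close>

lemma cring_ring_onD:
  fixes A :: "'a::comm_ring_1 set"
  assumes "cring (ring_on A)"
  shows "subring A (ring_on UNIV)"
proof -
  interpret cring "ring_on A" by fact
  have "- a \<in> A" if "a \<in> A" for a
  proof -
    have "a + \<ominus>\<^bsub>ring_on A\<^esub> a = 0" "\<ominus>\<^bsub>ring_on A\<^esub> a \<in> A"
      using r_neg[of a] a_inv_closed[of a] that by (simp_all add: ring_on_def)
    then show ?thesis by (metis neg_eq_iff_add_eq_0)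
  qed
  then show ?thesis
    using one_closed m_closed a_closed unfolding subring_ring_on_iff by (auto simp: ring_on_def)
qed

lemma local_units_iff: "u \<in> local_units P \<longleftrightarrow> u \<in> P \<and> u \<noteq> 0 \<and> 1 / u \<in> P"
  for u :: "'f::field"
proof -
  have "y = 1 / u" if "y * u = 1" for y
    using that by (metis eq_divide_imp mult_zero_right zero_neq_one)
  then show ?thesis
    by (force simp: local_units_def Units_def ring_on_def)
qed

lemma local_units_mult:
  fixes u w :: "'f::field"
  assumes "subring P (ring_on UNIV)" "u \<in> local_units P" "w \<in> local_units P"
  shows "u * w \<in> local_units P"
proof -
  have "1 / u * (1 / w) \<in> P"
    using assms unfolding local_units_iff subring_ring_on_iff by blast
  then show ?thesis
    using assms by (auto simp: local_units_iff subring_ring_on_iff)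
qed

lemma one_local_units:
  fixes P :: "'f::field set"
  assumes "subring P (ring_on UNIV)"
  shows "1 \<in> local_units P"
  using assms by (auto simp: local_units_iff subring_ring_on_iff)

text \<open>Primality makes \<open>A - q\<close> multiplicative, and \<open>0 \<in> q\<close> keeps
  denominators nonzero. The last claim later shows that a denominator does not vanish at the point
  under consideration.\<close>

lemma localization_facts:
  fixes A :: "'f::field set"
  assumes "primeideal q (ring_on A)"
  shows subring_localization: "subring (localization A q) (ring_on UNIV)"
    and subset_localization: "A \<subseteq> localization A q"
    and units_localization: "b \<in> A - q \<Longrightarrow> b \<in> local_units (localization A q)"
proof -
  interpret primeideal q "ring_on A" by fact
  have A: "subring A (ring_on UNIV)"
    by (intro cring_ring_onD is_cring)
  have one: "1 \<in> A - q"
    using A one_imp_carrier I_notcarr unfolding subring_ring_on_iff by (auto simp: ring_on_def)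
  have zero: "0 \<in> q"
    using additive_subgroup.zero_closed[OF additive_subgroup_axioms] by (simp add: ring_on_def)
  have mult: "a * b \<in> A - q" if "a \<in> A - q" "b \<in> A - q" for a b
    using that A I_prime[of a b] unfolding subring_ring_on_iff by (auto simp: ring_on_def)
  have A': "1 \<in> A" "\<And>a. a \<in> A \<Longrightarrow> - a \<in> A" "\<And>a b. a \<in> A \<Longrightarrow> b \<in> A \<Longrightarrow> a + b \<in> A"
    "\<And>a b. a \<in> A \<Longrightarrow> b \<in> A \<Longrightarrow> a * b \<in> A"
    using A by (auto simp: subring_ring_on_iff)
  have memI: "a / b \<in> localization A q" if "a \<in> A" "b \<in> A - q" for a b
    using that unfolding localization_def by blast
  have nz: "b \<noteq> 0" if "b \<in> A - q" for b
    using that zero by auto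
  show "subring (localization A q) (ring_on UNIV)"
    unfolding subring_ring_on_iff
  proof (intro conjI ballI)
    show "1 \<in> localization A q"
      using memI[of 1 1] one by simp
  next
    fix x assume "x \<in> localization A q"
    then obtain a b where x: "x = a / b" "a \<in> A" "b \<in> A - q"
      unfolding localization_def by blast
    show "- x \<in> localization A q"
      using memI[of "- a" b] x A' by simp
  next
    fix x y assume "x \<in> localization A q" "y \<in> localization A q"
    then obtain a b c d where x: "x = a / b" "a \<in> A" "b \<in> A - q"
      and y: "y = c / d" "c \<in> A" "d \<in> A - q"
      unfolding localization_def by blast
    have "x + y = (a * d + c * b) / (b * d)"
      using x y nz by (simp add: add_frac_eq)
    moreover have "(a * d + c * b) / (b * d) \<in> localization A q"
      using x y A' mult by (intro memI) auto
    ultimately show "x + y \<in> localization A q" by simp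
    have "(a * c) / (b * d) \<in> localization A q"
      using x y A' mult by (intro memI) auto
    then show "x * y \<in> localization A q"
      using x y by simp
  qed
  show "A \<subseteq> localization A q"
    using memI[OF _ one] by auto
  show "b \<in> local_units (localization A q)" if "b \<in> A - q"
    using memI[OF _ one, of b] memI[OF A'(1) that] that nz[OF that]
    by (auto simp: local_units_iff)
qed

lemma spec_pointsE:
  assumes "P \<in> spec_points A"
  obtains q where "primeideal q (ring_on A)" "P = localization A q"
  using assms unfolding spec_points_def by blast

lemma integral_projective_points:
  fixes X :: "'f::field set set"
  assumes "integral_projective \<iota> R X" "P \<in> X"
  shows integral_projective_subring: "subring P (ring_on UNIV)"
    and integral_projective_base: "\<iota> ` R \<subseteq> P"
proof -
  obtain xs i where "P \<in> spec_points (proj_chart \<iota> R xs i)"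
    using assms unfolding integral_projective_def by blast
  then obtain q where q: "primeideal q (ring_on (proj_chart \<iota> R xs i))"
    and P: "P = localization (proj_chart \<iota> R xs i) q"
    by (rule spec_pointsE)
  show "subring P (ring_on UNIV)"
    unfolding P by (rule subring_localization[OF q])
  have "\<iota> ` R \<subseteq> proj_chart \<iota> R xs i"
    unfolding proj_chart_def by (auto intro: generate_ring.incl)
  then show "\<iota> ` R \<subseteq> P"
    using subset_localization[OF q] P by auto
qed

text \<open>The chart ring is generated by constants and finitely many quotients. Lying in a chart
  thus becomes a condition on finitely many functions, which defines an open set.\<close>

lemma proj_chart_subset_iff:
  fixes \<iota> :: "'k::field \<Rightarrow> 'f::field"
  assumes "subring P (ring_on UNIV)" "\<iota> ` R \<subseteq> P"
  shows "proj_chart \<iota> R xs i \<subseteq> P \<longleftrightarrow> (\<forall>y\<in>set xs. y / xs ! i \<in> P)"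
proof
  interpret cring "ring_on (UNIV :: 'f set)"
    by (rule cring_ring_on_UNIV)
  assume "\<forall>y\<in>set xs. y / xs ! i \<in> P"
  then show "proj_chart \<iota> R xs i \<subseteq> P"
    using assms unfolding proj_chart_def by (intro generate_ring_min_subring1) (auto simp: ring_on_def)
next
  assume *: "proj_chart \<iota> R xs i \<subseteq> P"
  show "\<forall>y\<in>set xs. y / xs ! i \<in> P"
    using * unfolding proj_chart_def by (auto intro: generate_ring.incl)
qed


section \<open>Zariski open sets\<close>

lemma openin_zariski_domain: "openin (zariski X) {P \<in> X. f \<in> P}"
  unfolding zariski_def by (rule topology_generated_by_Basis) blast

text \<open>Irreducibility of X: the generic point lies in every subbasic set, hence in every
  non-empty open set, so any two of these meet.\<close>

lemma openin_zariski_generic: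
  assumes "UNIV \<in> X" "openin (zariski X) U" "U \<noteq> {}"
  shows "UNIV \<in> U"
proof -
  have "generate_topology_on {{P \<in> X. f \<in> P} | f. True} U"
    using assms(2) by (simp add: zariski_def openin_topology_generated_by_iff)
  then have "U \<noteq> {} \<longrightarrow> UNIV \<in> U"
    by induction (use assms(1) in auto)
  with assms(3) show ?thesis by simp
qed

lemma openin_zariski_units:
  fixes X :: "'f::field set set"
  assumes "0 \<notin> F" "finite F" "UNIV \<in> X"
  obtains U where "openin (zariski X) U" "UNIV \<in> U" "\<And>P. P \<in> U \<Longrightarrow> P \<in> X \<and> F \<subseteq> local_units P"
proof -
  have "\<exists>U. openin (zariski X) U \<and> UNIV \<in> U \<and> (\<forall>P\<in>U. P \<in> X \<and> F \<subseteq> local_units P)"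
    using assms(2,1)
  proof (induction F)
    case empty
    show ?case
      using openin_zariski_domain[of X 0] assms(3)
      by (intro exI[of _ "{P \<in> X. 0 \<in> P}"]) auto
  next
    case (insert f F)
    then obtain U where U: "openin (zariski X) U" "UNIV \<in> U"
      "\<forall>P\<in>U. P \<in> X \<and> F \<subseteq> local_units P"
      by auto
    have "openin (zariski X) (U \<inter> {P \<in> X. f \<in> P} \<inter> {P \<in> X. 1 / f \<in> P})"
      by (intro openin_Int U openin_zariski_domain)
    then show ?case
      using U insert.prems assms(3)
      by (intro exI[of _ "U \<inter> {P \<in> X. f \<in> P} \<inter> {P \<in> X. 1 / f \<in> P}"])
        (auto simp: local_units_iff)
  qed
  then show thesis using that by auto
qed


section \<open>Real divisors\<close>

lemma lookup_map_times:
  "Poly_Mapping.lookup (Poly_Mapping.map ((*) c) u) k = c * Poly_Mapping.lookup u k"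
  for c :: real
  by (simp add: map.rep_eq when_def)

lemma keys_map_times: "Poly_Mapping.keys (Poly_Mapping.map ((*) c) u) \<subseteq> Poly_Mapping.keys u"
  for c :: real
  by (auto simp: lookup_map_times simp flip: lookup_not_eq_zero_eq_in_keys)

lemma map_times_add:
  "Poly_Mapping.map ((*) c) (u + w) = Poly_Mapping.map ((*) c) u + Poly_Mapping.map ((*) c) w"
  for c :: real
  by (rule poly_mapping_eqI) (simp add: lookup_map_times lookup_add algebra_simps)

lemma map_times_diff:
  "Poly_Mapping.map ((*) c) (u - w) = Poly_Mapping.map ((*) c) u - Poly_Mapping.map ((*) c) w"
  for c :: real
  by (rule poly_mapping_eqI) (simp add: lookup_map_times lookup_minus algebra_simps)

lemma map_times_single:
  "Poly_Mapping.map ((*) c) (Poly_Mapping.single a r) = Poly_Mapping.single a (c * r)"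
  for c :: real
  by (rule poly_mapping_eqI) (simp add: lookup_map_times lookup_single when_def)

text \<open>Keys may disappear by cancellation or by scaling with 0, so sums over different key sets
  are compared on a common finite superset.\<close>

lemma sum_keys_superset:
  fixes u :: "'a \<Rightarrow>\<^sub>0 real"
  assumes "finite A" "Poly_Mapping.keys u \<subseteq> A" "\<And>a. F a 0 = 0"
  shows "(\<Sum>a\<in>Poly_Mapping.keys u. F a (Poly_Mapping.lookup u a)) =
    (\<Sum>a\<in>A. F a (Poly_Mapping.lookup u a))"
  using assms by (intro sum.mono_neutral_left) (auto simp: in_keys_iff)

lemma linear_extend_add: "linear_extend h (u + w) = linear_extend h u + linear_extend h w"
proof -
  let ?A = "Poly_Mapping.keys u \<union> Poly_Mapping.keys w"
  have "linear_extend h z = (\<Sum>a\<in>?A. Poly_Mapping.single (h a) (Poly_Mapping.lookup z a))"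
    if "Poly_Mapping.keys z \<subseteq> ?A" for z
    unfolding linear_extend_def using that by (intro sum_keys_superset) auto
  from this[of u] this[of w] this[of "u + w"] show ?thesis
    using keys_add[of u w] by (simp add: lookup_add single_add sum.distrib)
qed

lemma linear_extend_times:
  "linear_extend h (Poly_Mapping.map ((*) c) u) = Poly_Mapping.map ((*) c) (linear_extend h u)"
proof -
  have "linear_extend h (Poly_Mapping.map ((*) c) u) =
      (\<Sum>a\<in>Poly_Mapping.keys u. Poly_Mapping.single (h a) (c * Poly_Mapping.lookup u a))"
    unfolding linear_extend_def
    by (subst sum_keys_superset[OF finite_keys keys_map_times]) (auto simp: lookup_map_times)
  also have "\<dots> = (\<Sum>a\<in>Poly_Mapping.keys u.
      Poly_Mapping.map ((*) c) (Poly_Mapping.single (h a) (Poly_Mapping.lookup u a)))"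
    by (simp add: map_times_single)
  also have "\<dots> = Poly_Mapping.map ((*) c) (linear_extend h u)"
  proof -
    have map_sum: "(\<Sum>a\<in>A. Poly_Mapping.map ((*) c) (F a)) = Poly_Mapping.map ((*) c) (\<Sum>a\<in>A. F a)"
      if "finite A" for A and F :: "'c \<Rightarrow> ('d \<Rightarrow>\<^sub>0 real)"
      using that
      by induction (auto simp: map_times_add intro!: poly_mapping_eqI simp: lookup_map_times)
    show ?thesis
      unfolding linear_extend_def by (rule map_sum[OF finite_keys])
  qed
  finally show ?thesis .
qed

lemma log_abs_add: "log_abs x (u + w) = log_abs x u + log_abs x w"
proof -
  let ?A = "Poly_Mapping.keys u \<union> Poly_Mapping.keys w"
  have "log_abs x z = (\<Sum>a\<in>?A. Poly_Mapping.lookup z a * ln (abs_at x a))"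
    if "Poly_Mapping.keys z \<subseteq> ?A" for z
    unfolding log_abs_def
    using that sum_keys_superset[of ?A z "\<lambda>a r. r * ln (abs_at x a)"] by simp
  from this[of u] this[of w] this[of "u + w"] show ?thesis
    using keys_add[of u w] by (simp add: lookup_add sum.distrib algebra_simps)
qed

lemma log_abs_times: "log_abs x (Poly_Mapping.map ((*) c) u) = c * log_abs x u"
  unfolding log_abs_def
  using sum_keys_superset[OF finite_keys keys_map_times, of "\<lambda>a r. r * ln (abs_at x a)" c u]
  by (simp add: lookup_map_times sum_distrib_left mult.assoc)

text \<open>Scaling only changes the real parameter \<open>r\<close> of a generating
  relation.\<close>

lemma tensor_null_times: "u \<in> tensor_null G \<Longrightarrow> Poly_Mapping.map ((*) c) u \<in> tensor_null G"
proof (induction rule: tensor_null.induct)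
  case zero
  have "Poly_Mapping.map ((*) c) (0 :: 'a \<Rightarrow>\<^sub>0 real) = 0"
    by (rule poly_mapping_eqI) (simp add: lookup_map_times)
  then show ?case by (simp add: tensor_null.zero)
next
  case (plus u w)
  then show ?case by (simp add: map_times_add tensor_null.plus)
next
  case (relation a b r)
  then show ?case
    by (simp add: map_times_diff map_times_single tensor_null.relation)
qed

lemma rdivisor_nonneg_times:
  assumes "rdivisor_nonneg X D" "c \<ge> 0"
  shows "rdivisor_nonneg X (Poly_Mapping.map ((*) c) D)"
proof -
  obtain E where E: "tensor_eq (divisor_group X) D E"
    "\<forall>C\<in>Poly_Mapping.keys E. effective_cartier X C \<and> Poly_Mapping.lookup E C \<ge> 0"
    using assms(1) unfolding rdivisor_nonneg_def by blast
  show ?thesis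
    unfolding rdivisor_nonneg_def
  proof (intro exI[of _ "Poly_Mapping.map ((*) c) E"] conjI ballI)
    show "tensor_eq (divisor_group X) (Poly_Mapping.map ((*) c) D) (Poly_Mapping.map ((*) c) E)"
      using tensor_null_times[of "D - E" _ c] E(1) by (simp add: tensor_eq_def map_times_diff)
  qed (use E(2) assms(2) keys_map_times[of c E] in \<open>auto simp: lookup_map_times\<close>)
qed

lemma rdivisor_nonneg_add:
  assumes "rdivisor_nonneg X D" "rdivisor_nonneg X D'"
  shows "rdivisor_nonneg X (D + D')"
proof -
  obtain E E' where E: "tensor_eq (divisor_group X) D E"
    "\<forall>C\<in>Poly_Mapping.keys E. effective_cartier X C \<and> Poly_Mapping.lookup E C \<ge> 0"
    and E': "tensor_eq (divisor_group X) D' E'"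
    "\<forall>C\<in>Poly_Mapping.keys E'. effective_cartier X C \<and> Poly_Mapping.lookup E' C \<ge> 0"
    using assms unfolding rdivisor_nonneg_def by blast
  \<comment> \<open>A key of \<open>E + E'\<close> may be a key of only one summand; the other
    coefficient is then 0, so non-negativity is recorded for all \<open>C\<close>.\<close>
  have pos: "Poly_Mapping.lookup E C \<ge> 0" "Poly_Mapping.lookup E' C \<ge> 0" for C
    using E(2) E'(2) by (metis in_keys_iff order_refl)+
  show ?thesis
    unfolding rdivisor_nonneg_def
  proof (intro exI[of _ "E + E'"] conjI ballI)
    have "(D - E) + (D' - E') \<in> tensor_null (divisor_group X)"
      using E(1) E'(1) by (intro tensor_null.plus) (auto simp: tensor_eq_def)
    then show "tensor_eq (divisor_group X) (D + D') (E + E')"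
      by (simp add: tensor_eq_def algebra_simps)
  next
    fix C assume "C \<in> Poly_Mapping.keys (E + E')"
    then show "effective_cartier X C"
      using keys_add[of E E'] E(2) E'(2) by blast
    show "Poly_Mapping.lookup (E + E') C \<ge> 0"
      using pos by (simp add: lookup_add)
  qed
qed

section \<open>Triviality of a real divisor near the generic point\<close>

text \<open>The neutral divisor e is a genuine key of a formal combination and must be shown to
  vanish in the tensor product: e e = e turns the relation for (e, e) into minus one copy of e,
  whence the coefficient \<open>- r\<close> at the end.\<close>

lemma unit_divisor_null:
  fixes U :: "'f::field set set"
  assumes "\<And>P. P \<in> U \<Longrightarrow> subring P (ring_on UNIV)"
  shows "Poly_Mapping.single (principal_divisor U 1) r \<in> tensor_null (divisor_group U)"
proof -
  let ?e = "principal_divisor U (1 :: 'f)"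
  \<comment> \<open>Every local ring contains 0, so the domain of the function 0 is all of
    \<open>U\<close>.\<close>
  have "openin (zariski U) U"
    using openin_zariski_domain[of U 0] assms by (simp add: subring_zero Collect_conj_eq2 cong: conj_cong)
  then have carrier: "?e \<in> carrier (divisor_group U)"
    unfolding divisor_group_def cartier_divisors_def
    by simp (metis principal_divisor_def one_neq_zero)
  have "?e \<otimes>\<^bsub>divisor_group U\<^esub> ?e = ?e"
  proof
    fix P
    have "{a * b |a b. a \<in> local_units P \<and> b \<in> local_units P} = local_units P" if "P \<in> U"
    proof -
      have "u \<in> {a * b |a b. a \<in> local_units P \<and> b \<in> local_units P}" if "u \<in> local_units P" for u
        using one_local_units[OF assms[OF \<open>P \<in> U\<close>]] that by force
      then show ?thesis
        using local_units_mult[OF assms[OF that]] by auto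
    qed
    then show "(?e \<otimes>\<^bsub>divisor_group U\<^esub> ?e) P = ?e P"
      by (auto simp: divisor_group_def principal_divisor_def)
  qed
  then show ?thesis
    using tensor_null.relation[OF carrier carrier, of "- r"] by (simp add: single_uminus)
qed

lemma principal_divisor_unit:
  fixes f :: "'f::field"
  assumes "subring P (ring_on UNIV)" "f \<in> local_units P"
  shows "{f * u | u. u \<in> local_units P} = local_units P"
proof -
  have "1 / f \<in> local_units P"
    using assms(2) by (auto simp: local_units_iff)
  then have "u / f \<in> local_units P" if "u \<in> local_units P" for u
    using local_units_mult[OF assms(1) that] by fastforce
  moreover have "f \<noteq> 0"
    using assms(2) by (simp add: local_units_iff)
  ultimately have "u \<in> {f * u | u. u \<in> local_units P}" if "u \<in> local_units P" for u
    using that by (intro CollectI exI[of _ "u / f"]) auto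
  then show ?thesis
    using local_units_mult[OF assms] by auto
qed

text \<open>Only finitely many Cartier divisors occur in \<open>D\<close>. Each has a local equation
  f near the generic point, and f is a unit on a smaller open set, where the divisor is trivial. On
  the intersection of these sets \<open>D\<close> has the empty combination as local
  equation.\<close>

lemma openin_off_rsupport:
  fixes X :: "'f::field set set"
  assumes "UNIV \<in> X" and subr: "\<And>P. P \<in> X \<Longrightarrow> subring P (ring_on UNIV)" and "D \<in> rdivisors X"
  obtains U where "openin (zariski X) U" "UNIV \<in> U" "U \<inter> rsupport X D = {}"
proof -
  let ?trivial = "\<lambda>U C. \<forall>P\<in>U. P \<in> X \<and> C P = local_units P"
  have triv: "\<exists>U. openin (zariski X) U \<and> UNIV \<in> U \<and> ?trivial U C" if "C \<in> Poly_Mapping.keys D" for C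
  proof -
    have "C \<in> cartier_divisors X"
      using assms(3) that by (auto simp: rdivisors_def)
    then obtain U f where U: "openin (zariski X) U" "UNIV \<in> U" "f \<noteq> 0"
      "\<forall>Q\<in>U. C Q = principal_divisor X f Q"
      using assms(1) by (auto simp: cartier_divisors_def)
    obtain U' where U': "openin (zariski X) U'" "UNIV \<in> U'"
      "\<And>P. P \<in> U' \<Longrightarrow> P \<in> X \<and> {f} \<subseteq> local_units P"
      using openin_zariski_units[of "{f}" X] U(3) assms(1) by auto
    have "?trivial (U \<inter> U') C"
      using U(4) U'(3) principal_divisor_unit[OF subr] by (auto simp: principal_divisor_def)
    then show ?thesis
      using U U' by (intro exI[of _ "U \<inter> U'"]) auto
  qed
  have "\<exists>U. openin (zariski X) U \<and> UNIV \<in> U \<and> U \<subseteq> X \<and> (\<forall>C\<in>F. ?trivial U C)"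
    if "finite F" "F \<subseteq> Poly_Mapping.keys D" for F
    using that
  proof (induction F)
    case empty
    show ?case
      using openin_zariski_domain[of X 0] assms(1) by (intro exI[of _ "{P \<in> X. 0 \<in> P}"]) auto
  next
    case (insert C F)
    then obtain U where U: "openin (zariski X) U" "UNIV \<in> U" "U \<subseteq> X" "\<forall>C\<in>F. ?trivial U C"
      by auto
    obtain U' where U': "openin (zariski X) U'" "UNIV \<in> U'" "?trivial U' C"
      using triv[of C] insert.prems by auto
    show ?case
      using U U' by (intro exI[of _ "U \<inter> U'"]) auto
  qed
  from this[OF finite_keys order_refl]
  obtain U where U: "openin (zariski X) U" "UNIV \<in> U" "U \<subseteq> X"
    and UD: "\<forall>C\<in>Poly_Mapping.keys D. ?trivial U C"
    by blast
  have "(\<lambda>P. if P \<in> U then C P else {}) = principal_divisor U 1" if "C \<in> Poly_Mapping.keys D" for C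
    using UD that by (intro ext) (auto simp: principal_divisor_def)
  then have "rrestrict U D =
      (\<Sum>C\<in>Poly_Mapping.keys D. Poly_Mapping.single (principal_divisor U 1) (Poly_Mapping.lookup D C))"
    unfolding rrestrict_def linear_extend_def by (intro sum.cong) auto
  also have "\<dots> \<in> tensor_null (divisor_group U)"
  proof -
    have "(\<Sum>C\<in>F. Poly_Mapping.single (principal_divisor U 1) (Poly_Mapping.lookup D C))
        \<in> tensor_null (divisor_group U)" if "finite F" for F
      using that
    proof induction
      case empty
      show ?case by (simp add: tensor_null.zero)
    next
      case (insert C F)
      then show ?case
        using unit_divisor_null[of U] subr U(3) by (auto intro!: tensor_null.plus)
    qed
    then show ?thesis by simp
  qed
  finally have "local_equation U D 0"
    by (simp add: local_equation_def tensor_eq_def rprincipal_def linear_extend_def rrational_def)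
  then have "U \<inter> rsupport X D = {}"
    using U by (auto simp: rsupport_def)
  with U that show thesis by blast
qed

section \<open>Complete regularity of the analytification\<close>

lemma continuous_map_subtopology_preimageI:
  assumes "W \<subseteq> topspace T" "\<And>V. open V \<Longrightarrow> openin T {y \<in> W. k y \<in> V}"
  shows "continuous_map (subtopology T W) euclidean k"
  unfolding continuous_map_def
proof (intro conjI allI impI)
  fix V :: "'b set" assume "openin euclidean V"
  then have "openin T {y \<in> W. k y \<in> V}"
    using assms(2) by simp
  moreover have "{y \<in> topspace (subtopology T W). k y \<in> V} = {y \<in> W. k y \<in> V} \<inter> W"
    using assms(1) by auto
  ultimately show "openin (subtopology T W) {y \<in> topspace (subtopology T W). k y \<in> V}"
    unfolding openin_subtopology by blast
qed auto

text \<open>Complete regularity at one point and one neighbourhood. Positivity is asked only at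
  \<open>x\<close>, so the property passes to larger sets and, by products, to finite intersections;
  it can therefore be checked on a subbasis.\<close>

definition cozero_nbhd :: "'a topology \<Rightarrow> 'a \<Rightarrow> 'a set \<Rightarrow> bool" where
  "cozero_nbhd T x W \<longleftrightarrow> (\<exists>f. continuous_map T euclideanreal f \<and> (\<forall>y\<in>topspace T. 0 \<le> f y) \<and>
     0 < f x \<and> (\<forall>y\<in>topspace T. y \<notin> W \<longrightarrow> f y = 0))"

lemma cozero_nbhd_mono: "cozero_nbhd T x W \<Longrightarrow> W \<subseteq> W' \<Longrightarrow> cozero_nbhd T x W'"
  unfolding cozero_nbhd_def by blast

lemma cozero_nbhd_topspace: "cozero_nbhd T x (topspace T)"
  unfolding cozero_nbhd_def by (intro exI[of _ "\<lambda>_. 1"]) auto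

lemma cozero_nbhd_Int:
  assumes "cozero_nbhd T x W" "cozero_nbhd T x W'"
  shows "cozero_nbhd T x (W \<inter> W')"
proof -
  obtain f g where "continuous_map T euclideanreal f" "\<forall>y\<in>topspace T. 0 \<le> f y" "0 < f x"
    "\<forall>y\<in>topspace T. y \<notin> W \<longrightarrow> f y = 0"
    and "continuous_map T euclideanreal g" "\<forall>y\<in>topspace T. 0 \<le> g y" "0 < g x"
    "\<forall>y\<in>topspace T. y \<notin> W' \<longrightarrow> g y = 0"
    using assms unfolding cozero_nbhd_def by blast
  then show ?thesis
    unfolding cozero_nbhd_def
    by (intro exI[of _ "\<lambda>y. f y * g y"]) (auto intro: continuous_map_real_mult)
qed

lemma cozero_nbhd_finite:
  assumes "finite F" "\<And>c. c \<in> F \<Longrightarrow> cozero_nbhd T x {y \<in> topspace T. Q c y}"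
  shows "cozero_nbhd T x {y \<in> topspace T. \<forall>c\<in>F. Q c y}"
  using assms
proof induction
  case empty
  show ?case using cozero_nbhd_topspace by simp
next
  case (insert c F)
  then have "cozero_nbhd T x ({y \<in> topspace T. Q c y} \<inter> {y \<in> topspace T. \<forall>c\<in>F. Q c y})"
    by (intro cozero_nbhd_Int) auto
  then show ?case by (rule cozero_nbhd_mono) auto
qed

text \<open>Cutting off the function \<open>f\<close> that vanishes off \<open>W\<close> at half its value at \<open>x\<close> allows to multiply
  it with functions that are only defined and continuous on \<open>W\<close>.\<close>

lemma cozero_nbhd_preimage:
  fixes k :: "'a \<Rightarrow> 'b::metric_space"
  assumes "cozero_nbhd T x W" "openin T W" "x \<in> W"
    and k: "continuous_map (subtopology T W) euclidean k" and "open V" "k x \<in> V"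
  shows "cozero_nbhd T x {y \<in> W. k y \<in> V}"
proof -
  obtain f where f: "continuous_map T euclideanreal f" "\<And>y. y \<in> topspace T \<Longrightarrow> 0 \<le> f y"
    "0 < f x" "\<And>y. y \<in> topspace T \<Longrightarrow> y \<notin> W \<Longrightarrow> f y = 0"
    using assms(1) unfolding cozero_nbhd_def by blast
  obtain e where e: "0 < e" "\<And>z. dist z (k x) < e \<Longrightarrow> z \<in> V"
    using assms(5,6) unfolding open_dist by blast
  define c where "c = f x / 2"
  have c: "0 < c" "c < f x"
    using f(3) by (auto simp: c_def)
  \<comment> \<open>The second factor is positive only where \<open>k y\<close> is within
    \<open>e\<close> of \<open>k x\<close>, hence in \<open>V\<close>.\<close>
  define G where "G y = max 0 (f y - c) * max 0 (e - dist (k y) (k x))" for y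
  define F where "F y = (if y \<in> W then G y else 0)" for y
  have "continuous_map (subtopology T W) euclideanreal ((\<lambda>z. dist z (k x)) \<circ> k)"
    by (rule continuous_map_compose[OF k]) (auto intro: continuous_intros)
  then have dist_k: "continuous_map (subtopology T W) euclideanreal (\<lambda>y. dist (k y) (k x))"
    by (simp add: comp_def)
  have G: "continuous_map (subtopology T W) euclideanreal G"
    unfolding G_def
    by (intro continuous_map_real_mult continuous_map_real_max continuous_map_diff
        continuous_map_canonical_const continuous_map_from_subtopology[OF f(1)] dist_k)
  have "continuous_map T euclideanreal F"
  \<comment> \<open>The open sets \<open>W\<close> and {f < c} cover the space because f = 0 < c off
    \<open>W\<close>. On their overlap the first factor of \<open>G\<close> is 0, so
    \<open>G\<close> agrees with the zero function.\<close>
  proof (rule pasting_lemma[where I = "UNIV :: bool set"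
        and T = "\<lambda>b. if b then W else {y \<in> topspace T. f y < c}"
        and f = "\<lambda>b. if b then G else (\<lambda>_. 0)"])
    fix b :: bool
    have "openin T {y \<in> topspace T. f y \<in> {..<c}}"
      by (rule openin_continuous_map_preimage[OF f(1)]) auto
    then show "openin T (if b then W else {y \<in> topspace T. f y < c})"
      using assms(2) by auto
    show "continuous_map (subtopology T (if b then W else {y \<in> topspace T. f y < c}))
        euclideanreal (if b then G else (\<lambda>_. 0))"
      using G by auto
  next
    fix b b' y
    assume "y \<in> topspace T \<inter> (if b then W else {y \<in> topspace T. f y < c}) \<inter>
      (if b' then W else {y \<in> topspace T. f y < c})"
    then show "(if b then G else (\<lambda>_. 0)) y = (if b' then G else (\<lambda>_. 0)) y"
      by (auto simp: G_def split: if_splits)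
  next
    fix y assume y: "y \<in> topspace T"
    show "\<exists>b. b \<in> UNIV \<and> y \<in> (if b then W else {y \<in> topspace T. f y < c}) \<and>
        F y = (if b then G else (\<lambda>_. 0)) y"
      using f(4)[OF y] c y by (intro exI[of _ "y \<in> W"]) (auto simp: F_def)
  qed
  moreover have "0 < F x"
    using c e assms(3) by (simp add: F_def G_def)
  moreover have "0 \<le> F y" for y
    by (simp add: F_def G_def)
  moreover have "F y = 0" if "y \<notin> {y \<in> W. k y \<in> V}" for y
    using that e(2)[of "k y"] by (cases "y \<in> W") (auto simp: F_def G_def max_def not_less)
  ultimately show ?thesis
    unfolding cozero_nbhd_def by blast
qed

section \<open>Absolute values of rational functions at analytic points\<close>

lemma an_points_centre: "x \<in> an_points \<iota> X v \<Longrightarrow> centre x \<in> X"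
  by (cases v) auto

lemma const_padic_cauchy: "(\<lambda>_. c) \<in> padic_cauchy p"
  by (simp add: padic_cauchy_def padic_abs_def)

lemma single_base_change_carrier_iff:
  fixes p :: "'k::field_char_0 set"
  shows "Poly_Mapping.single f 1 \<in> base_change_carrier P (padic_cauchy p) \<longleftrightarrow> f \<in> P"
proof -
  \<comment> \<open>The carrier condition constrains all coefficients, also the zero ones, so both
    constant sequences 0 and 1 have to be Cauchy.\<close>
  have "Poly_Mapping.lookup (Poly_Mapping.single f (1 :: nat \<Rightarrow> 'k)) k \<in> padic_cauchy p" for k
    using const_padic_cauchy[of 0 p] const_padic_cauchy[of 1 p]
    by (auto simp: lookup_single when_def zero_fun_def one_fun_def)
  then show ?thesis
    by (auto simp: base_change_carrier_def)
qed

lemma abs_at_nonneg: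
  assumes "x \<in> an_points \<iota> X v" "f \<in> centre x"
  shows "0 \<le> abs_at x f"
proof (cases v)
  case (Finite_place p)
  then obtain P N where x: "x = Berkovich_point P N" and N: "berkovich_seminorm \<iota> p P N"
    using assms by auto
  show ?thesis
    using N assms(2) single_base_change_carrier_iff[of f P p]
    by (simp add: x berkovich_seminorm_def Let_def)
qed (use assms in auto)

lemma abs_at_eq_0_iff:
  assumes "x \<in> an_points \<iota> X v" "f \<in> centre x"
  shows "abs_at x f = 0 \<longleftrightarrow> f \<notin> local_units (centre x)"
proof (cases v)
  case (Finite_place p)
  then obtain P N where x: "x = Berkovich_point P N" and N: "berkovich_seminorm \<iota> p P N"
    using assms by auto
  show ?thesis
    using N assms(2) by (simp add: x berkovich_seminorm_def Let_def)
next
  case (Infinite_place \<sigma>)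
  then obtain P e where x: "x = Complex_point P e" and e: "complex_evaluation \<iota> \<sigma> P e"
    using assms by auto
  show ?thesis
    using e assms(2) by (simp add: x complex_evaluation_def)
qed

lemma abs_at_mult:
  fixes x :: "('k::field_char_0, 'f::field) an_point"
  assumes "x \<in> an_points \<iota> X v" "f \<in> centre x" "g \<in> centre x"
  shows "abs_at x (f * g) = abs_at x f * abs_at x g"
proof (cases v)
  case (Finite_place p)
  then obtain P N where x: "x = Berkovich_point P N" and N: "berkovich_seminorm \<iota> p P N"
    using assms by auto
  have "base_change_mult (Poly_Mapping.single f (1 :: nat \<Rightarrow> 'k)) (Poly_Mapping.single g 1) =
      Poly_Mapping.single (f * g) 1"
    by (simp add: base_change_mult_def)
  moreover have "Poly_Mapping.single f 1 \<in> base_change_carrier P (padic_cauchy p)"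
    "Poly_Mapping.single g 1 \<in> base_change_carrier P (padic_cauchy p)"
    using assms(2,3) by (simp_all add: x single_base_change_carrier_iff)
  ultimately show ?thesis
    using N unfolding x abs_at.simps berkovich_seminorm_def Let_def by metis
next
  case (Infinite_place \<sigma>)
  then obtain P e where x: "x = Complex_point P e" and e: "complex_evaluation \<iota> \<sigma> P e"
    using assms by auto
  then have "e (f * g) = e f * e g"
    using assms(2,3) ring_hom_mult[of e "ring_on P" "ring_on UNIV" f g]
    by (simp add: complex_evaluation_def ring_on_def)
  then show ?thesis by (simp add: x norm_mult)
qed

text \<open>|1| equals its own square by multiplicativity and is nonzero because 1 is a unit at the
  centre; this treats both kinds of points at once.\<close>

lemma abs_at_one:
  assumes "x \<in> an_points \<iota> X v" "subring (centre x) (ring_on UNIV)"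
  shows "abs_at x 1 = 1"
proof -
  have "1 \<in> local_units (centre x)"
    using assms(2) by (rule one_local_units)
  then have "1 \<in> centre x" "abs_at x 1 \<noteq> 0"
    using abs_at_eq_0_iff[OF assms(1), of 1] by (auto simp: local_units_iff)
  then show ?thesis
    using abs_at_mult[OF assms(1), of 1 1] by simp
qed

text \<open>At a finite place this is the subbasic set of the tensor of \<open>f\<close> with 1; at
  an infinite place \<open>V\<close> is pulled back along \<open>cmod\<close>. From here on
  \<open>abs_at\<close> hides the kind of place.\<close>

lemma openin_an_topology_abs_at:
  assumes "open V"
  shows "openin (an_topology \<iota> X v) {y \<in> an_points \<iota> X v. f \<in> centre y \<and> abs_at y f \<in> V}"
proof (cases v)
  case (Finite_place p)
  have eq: "{y \<in> an_points \<iota> X v. f \<in> centre y \<and> abs_at y f \<in> V} =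
      {y \<in> an_points \<iota> X (Finite_place p). Poly_Mapping.single f 1 \<in>
         base_change_carrier (centre y) (padic_cauchy p) \<and> seminorm y (Poly_Mapping.single f 1) \<in> V}"
    using Finite_place by (auto simp: single_base_change_carrier_iff)
  show ?thesis
    unfolding eq unfolding Finite_place an_topology.simps
    using assms by (intro topology_generated_by_Basis) blast
next
  case (Infinite_place \<sigma>)
  have eq: "{y \<in> an_points \<iota> X v. f \<in> centre y \<and> abs_at y f \<in> V} =
      {y \<in> an_points \<iota> X (Infinite_place \<sigma>). f \<in> centre y \<and> evaluation y f \<in> cmod -` V}"
    using Infinite_place by auto
  have "open (cmod -` V)"
    by (intro open_vimage assms continuous_intros)
  then show ?thesis
    unfolding eq unfolding Infinite_place an_topology.simps
    by (intro topology_generated_by_Basis) blast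
qed

lemma topspace_an_topology:
  assumes "\<And>P. P \<in> X \<Longrightarrow> subring P (ring_on UNIV)"
  shows "topspace (an_topology \<iota> X v) = an_points \<iota> X v"
proof
  show "topspace (an_topology \<iota> X v) \<subseteq> an_points \<iota> X v"
    by (cases v) auto
  have "{y \<in> an_points \<iota> X v. 0 \<in> centre y \<and> abs_at y 0 \<in> UNIV} = an_points \<iota> X v"
    using subring_zero assms an_points_centre by blast
  then show "an_points \<iota> X v \<subseteq> topspace (an_topology \<iota> X v)"
    using openin_subset[OF openin_an_topology_abs_at[of UNIV \<iota> X v 0]] by simp
qed

lemma openin_an_topology_domain:
  assumes "\<And>P. P \<in> X \<Longrightarrow> subring P (ring_on UNIV)" "finite F"
  shows "openin (an_topology \<iota> X v) {y \<in> an_points \<iota> X v. F \<subseteq> centre y}"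
  using assms(2)
proof induction
  case empty
  show ?case
    using openin_topspace[of "an_topology \<iota> X v"] topspace_an_topology[OF assms(1), of X \<iota> v] by simp
next
  case (insert f F)
  have "openin (an_topology \<iota> X v) ({y \<in> an_points \<iota> X v. f \<in> centre y \<and> abs_at y f \<in> UNIV} \<inter>
      {y \<in> an_points \<iota> X v. F \<subseteq> centre y})"
    by (intro openin_Int openin_an_topology_abs_at insert.IH) auto
  also have "\<dots> = {y \<in> an_points \<iota> X v. insert f F \<subseteq> centre y}"
    by auto
  finally show ?case .
qed

lemma continuous_map_abs_at:
  assumes "\<And>P. P \<in> X \<Longrightarrow> subring P (ring_on UNIV)" "openin (an_topology \<iota> X v) W"
    "\<And>y. y \<in> W \<Longrightarrow> f \<in> centre y"
  shows "continuous_map (subtopology (an_topology \<iota> X v) W) euclideanreal (\<lambda>y. abs_at y f)"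
proof (rule continuous_map_subtopology_preimageI)
  show W: "W \<subseteq> topspace (an_topology \<iota> X v)"
    by (rule openin_subset) fact
  fix V :: "real set" assume "open V"
  then have "openin (an_topology \<iota> X v)
      (W \<inter> {y \<in> an_points \<iota> X v. f \<in> centre y \<and> abs_at y f \<in> V})"
    by (intro openin_Int openin_an_topology_abs_at assms)
  also have "\<dots> = {y \<in> W. abs_at y f \<in> V}"
    using W assms(3) topspace_an_topology[OF assms(1), of X \<iota> v] by auto
  finally show "openin (an_topology \<iota> X v) {y \<in> W. abs_at y f \<in> V}" .
qed

text \<open>In homogeneous coordinates, the function \<open>|x\<^sub>i| / (|x\<^sub>0| + ... + |x\<^sub>n|)\<close>, which is continuous on
  the whole projective scheme and vanishes exactly off the \<open>i\<close>-th chart.\<close>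

definition chart_function :: "'f::field list \<Rightarrow> nat \<Rightarrow> ('k::field_char_0, 'f) an_point \<Rightarrow> real" where
  "chart_function xs i y =
     (if (\<forall>c\<in>set xs. c / xs ! i \<in> centre y) then 1 / (\<Sum>c\<in>set xs. abs_at y (c / xs ! i)) else 0)"

text \<open>The summand for c = x_i is |1| = 1.\<close>

lemma chart_sum_pos:
  assumes "y \<in> an_points \<iota> X v" "subring (centre y) (ring_on UNIV)"
    "\<forall>c\<in>set xs. c / xs ! i \<in> centre y" "i < length xs" "xs ! i \<noteq> 0"
  shows "0 < (\<Sum>c\<in>set xs. abs_at y (c / xs ! i))"
proof (rule sum_pos2[where i = "xs ! i"])
  show "0 < abs_at y (xs ! i / xs ! i)"
    using abs_at_one[OF assms(1,2)] assms(5) by simp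
qed (use assms abs_at_nonneg[OF assms(1)] in auto)

text \<open>If x_i/x_j is a unit at the centre, the point lies in the i-th chart and |x_i/x_j| is a
  common factor of the sum. Otherwise the point is off that chart and both sides are 0, which is why
  0 is the right default value.\<close>

lemma chart_function_change:
  assumes y: "y \<in> an_points \<iota> X v" and P: "subring (centre y) (ring_on UNIV)"
    and j: "\<forall>c\<in>set xs. c / xs ! j \<in> centre y"
    and ij: "i < length xs" "xs ! i \<noteq> 0" "j < length xs" "xs ! j \<noteq> 0"
  shows "chart_function xs i y =
    abs_at y (xs ! i / xs ! j) / (\<Sum>c\<in>set xs. abs_at y (c / xs ! j))"
proof (cases "xs ! i / xs ! j \<in> local_units (centre y)")
  case True
  have mem: "c / xs ! i \<in> centre y" if "c \<in> set xs" for c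
  proof -
    have "c / xs ! j * (1 / (xs ! i / xs ! j)) \<in> centre y"
      using P True j that unfolding subring_ring_on_iff local_units_iff by blast
    then show ?thesis using ij by simp
  qed
  have unit: "xs ! i / xs ! j \<in> centre y"
    using True by (simp add: local_units_iff)
  have "abs_at y (c / xs ! j) = abs_at y (xs ! i / xs ! j) * abs_at y (c / xs ! i)"
    if "c \<in> set xs" for c
    using abs_at_mult[OF y unit mem[OF that]] ij by simp
  then have "(\<Sum>c\<in>set xs. abs_at y (c / xs ! j)) =
      abs_at y (xs ! i / xs ! j) * (\<Sum>c\<in>set xs. abs_at y (c / xs ! i))"
    by (simp add: sum_distrib_left)
  moreover have "abs_at y (xs ! i / xs ! j) \<noteq> 0"
    using abs_at_eq_0_iff[OF y unit] True by simp
  ultimately show ?thesis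
    using mem by (simp add: chart_function_def)
next
  case False
  have unit: "xs ! i / xs ! j \<in> centre y"
    using j ij by simp
  have "\<not> (\<forall>c\<in>set xs. c / xs ! i \<in> centre y)"
  proof
    assume "\<forall>c\<in>set xs. c / xs ! i \<in> centre y"
    then have "xs ! j / xs ! i \<in> centre y"
      using ij by simp
    then show False
      using False unit ij by (simp add: local_units_iff)
  qed
  moreover have "abs_at y (xs ! i / xs ! j) = 0"
    using abs_at_eq_0_iff[OF y unit] False by simp
  ultimately show ?thesis
    by (auto simp: chart_function_def)
qed

text \<open>Continuity at the boundary of the i-th chart is invisible in the definition. On the j-th
  chart the function has a formula without case distinction, and the charts form an open
  cover.\<close>

lemma continuous_chart_function:
  fixes \<iota> :: "'k::field_char_0 \<Rightarrow> 'f::field"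
  assumes subr: "\<And>P. P \<in> X \<Longrightarrow> subring P (ring_on UNIV)"
    and cover: "\<And>P. P \<in> X \<Longrightarrow> \<exists>j<length xs. xs ! j \<noteq> 0 \<and> (\<forall>c\<in>set xs. c / xs ! j \<in> P)"
    and i: "i < length xs" "xs ! i \<noteq> 0"
  shows "continuous_map (an_topology \<iota> X v) euclideanreal (chart_function xs i)"
proof -
  let ?W = "\<lambda>j. {y \<in> an_points \<iota> X v. (\<lambda>c. c / xs ! j) ` set xs \<subseteq> centre y}"
  let ?u = "\<lambda>j y. abs_at y (xs ! i / xs ! j) / (\<Sum>c\<in>set xs. abs_at y (c / xs ! j))"
  let ?J = "{j. j < length xs \<and> xs ! j \<noteq> 0}"
  have change: "chart_function xs i y = ?u j y" if "j \<in> ?J" "y \<in> ?W j" for j y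
    using that i subr[OF an_points_centre] by (intro chart_function_change) auto
  show ?thesis
  proof (rule pasting_lemma[where I = ?J and T = ?W and f = ?u])
    show W: "openin (an_topology \<iota> X v) (?W j)" if "j \<in> ?J" for j
      by (intro openin_an_topology_domain subr) auto
    have abs: "continuous_map (subtopology (an_topology \<iota> X v) (?W j)) euclideanreal
        (\<lambda>y. abs_at y (c / xs ! j))" if "j \<in> ?J" "c \<in> set xs" for j c
      by (rule continuous_map_abs_at[OF subr W[OF that(1)]]) (use that in auto)
    have nz: "(\<Sum>c\<in>set xs. abs_at y (c / xs ! j)) \<noteq> 0" if "j \<in> ?J" "y \<in> ?W j" for j y
      using chart_sum_pos[of y \<iota> X v xs j] subr[OF an_points_centre] that by fastforce
    show "continuous_map (subtopology (an_topology \<iota> X v) (?W j)) euclideanreal (?u j)"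
      if "j \<in> ?J" for j
    proof (rule continuous_map_real_divide)
      show "continuous_map (subtopology (an_topology \<iota> X v) (?W j)) euclideanreal
          (\<lambda>y. \<Sum>c\<in>set xs. abs_at y (c / xs ! j))"
        using abs[OF that] by (intro continuous_map_sum) auto
      show "continuous_map (subtopology (an_topology \<iota> X v) (?W j)) euclideanreal
          (\<lambda>y. abs_at y (xs ! i / xs ! j))"
        using abs[OF that] i by simp
    qed (use nz[OF that] in auto)
    show "?u j y = ?u j' y" if "j \<in> ?J" "j' \<in> ?J"
      "y \<in> topspace (an_topology \<iota> X v) \<inter> ?W j \<inter> ?W j'" for j j' y
      using change[of j y] change[of j' y] that by simp
    show "\<exists>j. j \<in> ?J \<and> y \<in> ?W j \<and> chart_function xs i y = ?u j y"
      if "y \<in> topspace (an_topology \<iota> X v)" for y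
    proof -
      have y: "y \<in> an_points \<iota> X v"
        using that topspace_an_topology[OF subr] by blast
      obtain j where "j \<in> ?J" "y \<in> ?W j"
        using cover[OF an_points_centre[OF y]] y by auto
      then show ?thesis using change[of j y] by blast
    qed
  qed
qed

section \<open>Cozero neighbourhoods in the analytification\<close>

text \<open>Write f = a/b with \<open>a\<close>, \<open>b\<close> in the ring of a chart containing
  \<open>x\<close> and b invertible at \<open>x\<close>. The chart is a cozero set by its chart
  function, and inside it f is regular wherever |b| > 0. The domain of f may be larger, but a
  smaller neighbourhood suffices.\<close>

lemma cozero_nbhd_domain:
  fixes \<iota> :: "'k::field_char_0 \<Rightarrow> 'f::field"
  assumes proj: "integral_projective \<iota> UNIV X" and x: "x \<in> an_points \<iota> X v" and f: "f \<in> centre x"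
  shows "cozero_nbhd (an_topology \<iota> X v) x {y \<in> an_points \<iota> X v. f \<in> centre y}"
proof -
  let ?T = "an_topology \<iota> X v"
  note subr = integral_projective_subring[OF proj]
  note top = topspace_an_topology[OF subr, of X \<iota> v]
  obtain xs where X: "X = (\<Union>i\<in>{i. i < length xs \<and> xs ! i \<noteq> 0}. spec_points (proj_chart \<iota> UNIV xs i))"
    using proj unfolding integral_projective_def by blast
  have chart_iff: "proj_chart \<iota> UNIV xs i \<subseteq> P \<longleftrightarrow> (\<forall>c\<in>set xs. c / xs ! i \<in> P)" if "P \<in> X" for P i
    using proj_chart_subset_iff[OF subr[OF that] integral_projective_base[OF proj that]] .
  have cover: "\<exists>j<length xs. xs ! j \<noteq> 0 \<and> (\<forall>c\<in>set xs. c / xs ! j \<in> P)" if PX: "P \<in> X" for P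
  proof -
    obtain j where j: "j < length xs" "xs ! j \<noteq> 0" "P \<in> spec_points (proj_chart \<iota> UNIV xs j)"
      using PX X by auto
    then have "proj_chart \<iota> UNIV xs j \<subseteq> P"
      by (metis spec_pointsE subset_localization)
    then show ?thesis
      using j chart_iff[OF PX] by blast
  qed
  obtain i where i: "i < length xs" "xs ! i \<noteq> 0"
    and "centre x \<in> spec_points (proj_chart \<iota> UNIV xs i)"
    using an_points_centre[OF x] X by auto
  then obtain q where q: "primeideal q (ring_on (proj_chart \<iota> UNIV xs i))"
    and loc: "centre x = localization (proj_chart \<iota> UNIV xs i) q"
    by (auto elim: spec_pointsE)
  then obtain a b where ab: "f = a / b" "a \<in> proj_chart \<iota> UNIV xs i"
    "b \<in> proj_chart \<iota> UNIV xs i - q"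
    using f unfolding localization_def by blast
  define W where "W = {y \<in> an_points \<iota> X v. (\<lambda>c. c / xs ! i) ` set xs \<subseteq> centre y}"
  have chart: "proj_chart \<iota> UNIV xs i \<subseteq> centre y" if "y \<in> W" for y
    using that chart_iff[OF an_points_centre] unfolding W_def by blast
  have xW: "x \<in> W"
    using x chart_iff[OF an_points_centre[OF x], of i] subset_localization[OF q] loc
    unfolding W_def by auto
  have W: "openin ?T W"
    unfolding W_def by (intro openin_an_topology_domain subr) auto
  have pos: "0 < chart_function xs i y" if "y \<in> W" for y
    using chart_sum_pos[of y \<iota> X v xs i] subr[OF an_points_centre[of y]] i that
    by (auto simp: W_def chart_function_def image_subset_iff)
  have "cozero_nbhd ?T x W"
    unfolding cozero_nbhd_def
  proof (intro exI[of _ "chart_function xs i"] conjI ballI impI)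
    show "continuous_map ?T euclideanreal (chart_function xs i)"
      using continuous_chart_function[OF subr cover i] .
    show "0 < chart_function xs i x"
      using pos[OF xW] .
    show zero: "chart_function xs i y = 0" if "y \<in> topspace ?T" "y \<notin> W" for y
      using that top by (auto simp: W_def chart_function_def)
    show "0 \<le> chart_function xs i y" if "y \<in> topspace ?T" for y
      using zero[OF that] pos[of y] by fastforce
  qed
  moreover have "continuous_map (subtopology ?T W) euclideanreal (\<lambda>y. abs_at y b)"
    by (rule continuous_map_abs_at[OF subr W]) (use chart ab in auto)
  moreover have "abs_at x b \<in> {0<..}"
    using abs_at_eq_0_iff[OF x, of b] abs_at_nonneg[OF x, of b] units_localization[OF q ab(3)] loc
    by (auto simp: local_units_iff)
  ultimately have "cozero_nbhd ?T x {y \<in> W. abs_at y b \<in> {0<..}}"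
    using W xW by (intro cozero_nbhd_preimage) auto
  then show ?thesis
  proof (rule cozero_nbhd_mono, safe)
    fix y assume y: "y \<in> W" "0 < abs_at y b"
    then show y': "y \<in> an_points \<iota> X v"
      by (simp add: W_def)
    have mem: "a \<in> centre y" "b \<in> centre y"
      using chart[OF y(1)] ab by auto
    then have "1 / b \<in> centre y"
      using abs_at_eq_0_iff[OF y'] y(2) by (fastforce simp: local_units_iff)
    then have "a * (1 / b) \<in> centre y"
      using mem subr[OF an_points_centre[OF y']] unfolding subring_ring_on_iff by blast
    then show "f \<in> centre y"
      using ab(1) by simp
  qed
qed

lemma cozero_nbhd_domain_finite:
  fixes \<iota> :: "'k::field_char_0 \<Rightarrow> 'f::field"
  assumes proj: "integral_projective \<iota> UNIV X" and x: "x \<in> an_points \<iota> X v"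
    and F: "finite F" "F \<subseteq> centre x"
  shows "cozero_nbhd (an_topology \<iota> X v) x {y \<in> an_points \<iota> X v. F \<subseteq> centre y}"
  using cozero_nbhd_finite[OF F(1), of "an_topology \<iota> X v" x "\<lambda>f y. f \<in> centre y"]
    cozero_nbhd_domain[OF proj x] F(2)
    topspace_an_topology[OF integral_projective_subring[OF proj], of X \<iota> v]
  by (auto simp: subset_eq)

text \<open>One induction principle for the two generated topologies, so that intersections and
  unions are handled once. The empty set is the union of the empty family.\<close>

lemma openin_an_topology_generate:
  assumes "openin (an_topology \<iota> X v) W"
    and "\<And>A B. R A \<Longrightarrow> R B \<Longrightarrow> R (A \<inter> B)" "\<And>\<A>. (\<And>A. A \<in> \<A> \<Longrightarrow> R A) \<Longrightarrow> R (\<Union>\<A>)"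
    and "\<And>p h V. v = Finite_place p \<Longrightarrow> open V \<Longrightarrow> R {y \<in> an_points \<iota> X v.
      h \<in> base_change_carrier (centre y) (padic_cauchy p) \<and> seminorm y h \<in> V}"
    and "\<And>\<sigma> f V. v = Infinite_place \<sigma> \<Longrightarrow> open V \<Longrightarrow>
      R {y \<in> an_points \<iota> X v. f \<in> centre y \<and> evaluation y f \<in> V}"
  shows "R W"
proof (cases v)
  case (Finite_place p)
  have "generate_topology_on {{y \<in> an_points \<iota> X v.
      h \<in> base_change_carrier (centre y) (padic_cauchy p) \<and> seminorm y h \<in> V} | h V. open V} W"
    using assms(1) by (simp only: Finite_place an_topology.simps openin_topology_generated_by_iff)
  then show ?thesis
  proof induction
    case Empty
    show ?case using assms(3)[of "{}"] by simp
  next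
    case (Basis B)
    then show ?case using assms(4)[OF Finite_place] by auto
  qed (simp_all add: assms(2,3))
next
  case (Infinite_place \<sigma>)
  have "generate_topology_on {{y \<in> an_points \<iota> X v. f \<in> centre y \<and> evaluation y f \<in> V} | f V. open V} W"
    using assms(1) by (simp only: Infinite_place an_topology.simps openin_topology_generated_by_iff)
  then show ?thesis
  proof induction
    case Empty
    show ?case using assms(3)[of "{}"] by simp
  next
    case (Basis B)
    then show ?case using assms(5)[OF Infinite_place] by auto
  qed (simp_all add: assms(2,3))
qed

text \<open>A subbasic set is a preimage under a function on the domain of finitely many rational
  functions. That domain is a cozero neighbourhood, so the cut-off argument of
  \<open>cozero_nbhd_preimage\<close> applies.\<close>

lemma cozero_nbhd_openin:
  fixes \<iota> :: "'k::field_char_0 \<Rightarrow> 'f::field"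
  assumes proj: "integral_projective \<iota> UNIV X" and x: "x \<in> an_points \<iota> X v"
    and "openin (an_topology \<iota> X v) W" "x \<in> W"
  shows "cozero_nbhd (an_topology \<iota> X v) x W"
proof -
  let ?T = "an_topology \<iota> X v"
  note subr = integral_projective_subring[OF proj]
  have "x \<in> W \<longrightarrow> cozero_nbhd ?T x W"
    using assms(3)
  proof (rule openin_an_topology_generate[where R = "\<lambda>W. x \<in> W \<longrightarrow> cozero_nbhd ?T x W"])
    fix A B assume "x \<in> A \<longrightarrow> cozero_nbhd ?T x A" "x \<in> B \<longrightarrow> cozero_nbhd ?T x B"
    then show "x \<in> A \<inter> B \<longrightarrow> cozero_nbhd ?T x (A \<inter> B)"
      by (auto intro: cozero_nbhd_Int)
  next
    fix \<A> assume "\<And>A. A \<in> \<A> \<Longrightarrow> x \<in> A \<longrightarrow> cozero_nbhd ?T x A"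
    then show "x \<in> \<Union>\<A> \<longrightarrow> cozero_nbhd ?T x (\<Union>\<A>)"
      by (meson UnionE Union_upper cozero_nbhd_mono)
  next
    fix p and h :: "'f \<Rightarrow>\<^sub>0 (nat \<Rightarrow> 'k)" and V :: "real set"
    assume v: "v = Finite_place p" and V: "open V"
    let ?B = "\<lambda>V. {y \<in> an_points \<iota> X v.
      h \<in> base_change_carrier (centre y) (padic_cauchy p) \<and> seminorm y h \<in> V}"
    let ?W = "{y \<in> an_points \<iota> X v. Poly_Mapping.keys h \<subseteq> centre y}"
    show "x \<in> ?B V \<longrightarrow> cozero_nbhd ?T x (?B V)"
    proof
      assume xB: "x \<in> ?B V"
      \<comment> \<open>As \<open>x\<close> lies in the set, the coefficients of \<open>h\<close>
        are Cauchy; all that remains of the carrier condition at \<open>y\<close> concerns the keys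
        of \<open>h\<close>.\<close>
      then have eq: "?B V' = {y \<in> ?W. seminorm y h \<in> V'}" for V'
        by (auto simp: base_change_carrier_def)
      have open_B: "openin ?T (?B V')" if "open V'" for V'
        unfolding v an_topology.simps using that by (intro topology_generated_by_Basis) blast
      have "cozero_nbhd ?T x {y \<in> ?W. seminorm y h \<in> V}"
      proof (rule cozero_nbhd_preimage)
        show "openin ?T ?W"
          by (intro openin_an_topology_domain subr) auto
        then show "continuous_map (subtopology ?T ?W) euclidean (\<lambda>y. seminorm y h)"
          using open_B unfolding eq by (intro continuous_map_subtopology_preimageI openin_subset)
        show "cozero_nbhd ?T x ?W"
          using xB by (intro cozero_nbhd_domain_finite[OF proj x]) (auto simp: base_change_carrier_def)
      qed (use xB V in \<open>auto simp: base_change_carrier_def\<close>)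
      then show "cozero_nbhd ?T x (?B V)"
        unfolding eq .
    qed
  next
    fix \<sigma> f and V :: "complex set"
    assume v: "v = Infinite_place \<sigma>" and V: "open V"
    let ?B = "\<lambda>V. {y \<in> an_points \<iota> X v. f \<in> centre y \<and> evaluation y f \<in> V}"
    let ?W = "{y \<in> an_points \<iota> X v. f \<in> centre y}"
    have eq: "?B V' = {y \<in> ?W. evaluation y f \<in> V'}" for V'
      by auto
    have open_B: "openin ?T (?B V')" if "open V'" for V'
      unfolding v an_topology.simps using that by (intro topology_generated_by_Basis) blast
    show "x \<in> ?B V \<longrightarrow> cozero_nbhd ?T x (?B V)"
      unfolding eq
    proof
      assume xB: "x \<in> {y \<in> ?W. evaluation y f \<in> V}"
      show "cozero_nbhd ?T x {y \<in> ?W. evaluation y f \<in> V}"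
      proof (rule cozero_nbhd_preimage)
        show "openin ?T ?W"
          using openin_an_topology_domain[OF subr, of X "{f}"] by simp
        then show "continuous_map (subtopology ?T ?W) euclidean (\<lambda>y. evaluation y f)"
          using open_B unfolding eq by (intro continuous_map_subtopology_preimageI openin_subset)
        show "cozero_nbhd ?T x ?W"
          using xB by (intro cozero_nbhd_domain[OF proj x]) auto
      qed (use xB V in auto)
    qed
  qed
  with assms(4) show ?thesis by simp
qed


section \<open>Perturbation of effective adelic divisors\<close>

text \<open>Containing the generic point, unlike being non-empty, is visibly stable under
  intersection.\<close>

lemma adelic_nonneg_generic:
  assumes "UNIV \<in> X" "adelic_nonneg \<iota> X Db" "w \<in> places"
  obtains U where "openin (zariski X) U" "UNIV \<in> U"
    "\<And>y. y \<in> an_points \<iota> X w \<Longrightarrow> centre y \<in> U \<Longrightarrow> 0 \<le> snd Db w y"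
  using assms openin_zariski_generic[OF assms(1)] unfolding adelic_nonneg_def by blast

text \<open>Bounding \<open>E\<close> by \<epsilon> (D + (s)) in D + E - t \<zeta> + (\<phi>) \<ge>
  0 gives (1 + \<epsilon>) D - t \<zeta> + (\<phi>) + \<epsilon> (s) \<ge> 0. Division by 1 +
  \<epsilon> produces the new section and the new parameter t / (1 + \<epsilon>).\<close>

lemma adelic_nonneg_perturb:
  fixes \<iota> :: "'k::field_char_0 \<Rightarrow> 'f::field"
  assumes generic: "UNIV \<in> X"
    and pos: "adelic_nonneg \<iota> X (adelic_add (D, g) (adelic_principal X s))"
    and "\<epsilon> > 0" "fst E = 0"
    and E: "\<And>w. w \<in> places \<Longrightarrow> \<exists>U. openin (zariski X) U \<and> U \<noteq> {} \<and>
      (\<forall>y\<in>an_points \<iota> X w. centre y \<in> U \<longrightarrow> snd E w y \<le> \<epsilon> * (g w y - 2 * log_abs y s))"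
    and \<phi>: "adelic_nonneg \<iota> X (adelic_add (adelic_add (adelic_add (D, g) E)
      (pullback_base (\<lambda>v. - t * \<zeta> v))) (adelic_principal X \<phi>))"
  shows "adelic_nonneg \<iota> X (adelic_add (adelic_add (D, g)
      (pullback_base (\<lambda>v. - (t / (1 + \<epsilon>)) * \<zeta> v)))
      (adelic_principal X (Poly_Mapping.map ((*) (1 / (1 + \<epsilon>))) (\<phi> + Poly_Mapping.map ((*) \<epsilon>) s))))"
    (is "adelic_nonneg \<iota> X ?R")
  unfolding adelic_nonneg_def
proof (intro conjI ballI)
  let ?c = "1 / (1 + \<epsilon>)"
  have nonneg: "rdivisor_nonneg X (D + rprincipal X s)" "rdivisor_nonneg X (D + rprincipal X \<phi>)"
    using pos \<phi> \<open>fst E = 0\<close>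
    by (simp_all add: adelic_nonneg_def adelic_add_def adelic_principal_def pullback_base_def)
  have "rdivisor_nonneg X (Poly_Mapping.map ((*) ?c)
      ((D + rprincipal X \<phi>) + Poly_Mapping.map ((*) \<epsilon>) (D + rprincipal X s)))"
    using \<open>\<epsilon> > 0\<close>
    by (intro rdivisor_nonneg_times rdivisor_nonneg_add[OF nonneg(2) rdivisor_nonneg_times[OF nonneg(1)]])
      auto
  also have "Poly_Mapping.map ((*) ?c)
      ((D + rprincipal X \<phi>) + Poly_Mapping.map ((*) \<epsilon>) (D + rprincipal X s)) = fst ?R"
  proof (rule poly_mapping_eqI)
    fix C
    show "Poly_Mapping.lookup (Poly_Mapping.map ((*) ?c)
        ((D + rprincipal X \<phi>) + Poly_Mapping.map ((*) \<epsilon>) (D + rprincipal X s))) C =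
        Poly_Mapping.lookup (fst ?R) C"
      using \<open>\<epsilon> > 0\<close>
      by (simp add: adelic_add_def adelic_principal_def pullback_base_def rprincipal_def
          linear_extend_add linear_extend_times lookup_map_times lookup_add field_simps)
  qed
  finally show "rdivisor_nonneg X (fst ?R)" .
next
  fix w :: "'k place" assume w: "w \<in> places"
  obtain U where U: "openin (zariski X) U" "U \<noteq> {}"
    "\<And>y. y \<in> an_points \<iota> X w \<Longrightarrow> centre y \<in> U \<Longrightarrow> snd E w y \<le> \<epsilon> * (g w y - 2 * log_abs y s)"
    using E[OF w] by blast
  obtain U' where U': "openin (zariski X) U'" "UNIV \<in> U'"
    "\<And>y. y \<in> an_points \<iota> X w \<Longrightarrow> centre y \<in> U' \<Longrightarrow>
      0 \<le> g w y + snd E w y - t * \<zeta> w - 2 * log_abs y \<phi>"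
    using adelic_nonneg_generic[OF generic \<phi> w]
    by (auto simp: adelic_add_def adelic_principal_def pullback_base_def)
  define c where "c = 1 / (1 + \<epsilon>)"
  have c: "0 \<le> c" "c * (1 + \<epsilon>) = 1"
    using \<open>\<epsilon> > 0\<close> by (simp_all add: c_def)
  show "\<exists>U. openin (zariski X) U \<and> U \<noteq> {} \<and>
      (\<forall>y\<in>an_points \<iota> X w. centre y \<in> U \<longrightarrow> 0 \<le> snd ?R w y)"
  proof (intro exI[of _ "U \<inter> U'"] conjI ballI impI)
    show "openin (zariski X) (U \<inter> U')"
      using U U' by (intro openin_Int)
    show "U \<inter> U' \<noteq> {}"
      using openin_zariski_generic[OF generic] U U' by blast
    fix y assume "y \<in> an_points \<iota> X w" "centre y \<in> U \<inter> U'"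
    then have "0 \<le> (1 + \<epsilon>) * g w y - t * \<zeta> w - 2 * (log_abs y \<phi> + \<epsilon> * log_abs y s)"
      using U(3)[of y] U'(3)[of y] by (auto simp: algebra_simps)
    then have "0 \<le> c * ((1 + \<epsilon>) * g w y - t * \<zeta> w - 2 * (log_abs y \<phi> + \<epsilon> * log_abs y s))"
      using c(1) by (intro mult_nonneg_nonneg)
    also have "\<dots> = (c * (1 + \<epsilon>)) * g w y - t * c * \<zeta> w
        - 2 * (c * (log_abs y \<phi> + \<epsilon> * log_abs y s))"
      by (simp add: algebra_simps)
    also have "\<dots> = g w y - t / (1 + \<epsilon>) * \<zeta> w - 2 * (c * (log_abs y \<phi> + \<epsilon> * log_abs y s))"
      unfolding c(2) by (simp add: c_def)
    also have "\<dots> = g w y - t / (1 + \<epsilon>) * \<zeta> w - 2 * log_abs y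
        (Poly_Mapping.map ((*) (1 / (1 + \<epsilon>))) (\<phi> + Poly_Mapping.map ((*) \<epsilon>) s))"
      by (simp only: c_def log_abs_add log_abs_times)
    also have "\<dots> = snd ?R w y"
      by (simp add: adelic_add_def adelic_principal_def pullback_base_def)
    finally show "0 \<le> snd ?R w y" .
  qed
qed

text \<open>If \<open>E \<le> \<epsilon> (D + (s))\<close>, then \<open>D + E\<close> is dominated by \<open>(1 + \<epsilon>) D\<close> up to a principal divisor, and
  the slope is homogeneous.\<close>

lemma mu_max_asy_perturb_le:
  assumes generic: "UNIV \<in> X" and "s \<in> rrational"
    and pos: "adelic_nonneg \<iota> X (adelic_add (D, g) (adelic_principal X s))"
    and mu: "mu_max_asy \<iota> X \<zeta> (D, g) \<le> 0"
    and "\<epsilon> > 0" "fst E = 0"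
    and E: "\<And>w. w \<in> places \<Longrightarrow> \<exists>U. openin (zariski X) U \<and> U \<noteq> {} \<and>
      (\<forall>y\<in>an_points \<iota> X w. centre y \<in> U \<longrightarrow> snd E w y \<le> \<epsilon> * (g w y - 2 * log_abs y s))"
  shows "mu_max_asy \<iota> X \<zeta> (adelic_add (D, g) E) \<le> 0"
  unfolding mu_max_asy_def
proof (rule Sup_least, clarify)
  fix t assume "dirichlet_property \<iota> X
    (adelic_add (adelic_add (D, g) E) (pullback_base (\<lambda>v. - t * \<zeta> v)))"
  then obtain \<phi> where \<phi>: "\<phi> \<in> rrational" "adelic_nonneg \<iota> X (adelic_add (adelic_add (adelic_add (D, g) E)
      (pullback_base (\<lambda>v. - t * \<zeta> v))) (adelic_principal X \<phi>))"
    unfolding dirichlet_property_def by blast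
  let ?\<psi> = "Poly_Mapping.map ((*) (1 / (1 + \<epsilon>))) (\<phi> + Poly_Mapping.map ((*) \<epsilon>) s)"
  have "?\<psi> \<in> rrational"
    using \<phi>(1) \<open>s \<in> rrational\<close>
    by (simp add: rrational_def in_keys_iff lookup_map_times lookup_add)
  then have "dirichlet_property \<iota> X
      (adelic_add (D, g) (pullback_base (\<lambda>v. - (t / (1 + \<epsilon>)) * \<zeta> v)))"
    using adelic_nonneg_perturb[OF generic pos \<open>\<epsilon> > 0\<close> \<open>fst E = 0\<close> E \<phi>(2)]
    unfolding dirichlet_property_def by blast
  then have "ereal (t / (1 + \<epsilon>)) \<le> mu_max_asy \<iota> X \<zeta> (D, g)"
    unfolding mu_max_asy_def by (intro Sup_upper imageI CollectI)
  with mu have "ereal (t / (1 + \<epsilon>)) \<le> 0"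
    by (rule order_trans[rotated])
  then have "t / (1 + \<epsilon>) \<le> 0"
    by simp
  then show "ereal t \<le> 0"
    using \<open>\<epsilon> > 0\<close> by (simp add: divide_le_0_iff)
qed

lemma O_bar_times: "snd (O_bar v (\<lambda>x. c * f x)) w y = c * snd (O_bar v f) w y"
  by (cases v) (auto simp: O_bar_def algebra_simps)

text \<open>The bound on \<open>f\<close> scales with \<epsilon>, so every single difference
  quotient is already non-positive, not only their limit superior.\<close>

lemma Psi_mu_nonpos:
  assumes "UNIV \<in> X" "s \<in> rrational"
    and "adelic_nonneg \<iota> X (adelic_add (D, g) (adelic_principal X s))"
    and mu: "mu_max_asy \<iota> X \<zeta> (D, g) = 0"
    and f: "\<And>w. w \<in> places \<Longrightarrow> \<exists>U. openin (zariski X) U \<and> U \<noteq> {} \<and>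
      (\<forall>y\<in>an_points \<iota> X w. centre y \<in> U \<longrightarrow> snd (O_bar v f) w y \<le> g w y - 2 * log_abs y s)"
  shows "Psi_mu \<iota> X \<zeta> (D, g) v f \<le> 0"
  unfolding Psi_mu_def
proof (rule Limsup_bounded)
  have "(mu_max_asy \<iota> X \<zeta> (adelic_add (D, g) (O_bar v (\<lambda>x. \<epsilon> * f x))) - mu_max_asy \<iota> X \<zeta> (D, g))
      / ereal \<epsilon> \<le> 0" if "\<epsilon> > 0" for \<epsilon>
  proof -
    have "mu_max_asy \<iota> X \<zeta> (adelic_add (D, g) (O_bar v (\<lambda>x. \<epsilon> * f x))) \<le> 0"
    proof (rule mu_max_asy_perturb_le[OF assms(1-3) _ that])
      show "mu_max_asy \<iota> X \<zeta> (D, g) \<le> 0"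
        using mu by simp
      show "fst (O_bar v (\<lambda>x. \<epsilon> * f x)) = 0"
        by (simp add: O_bar_def)
      show "\<exists>U. openin (zariski X) U \<and> U \<noteq> {} \<and> (\<forall>y\<in>an_points \<iota> X w. centre y \<in> U \<longrightarrow>
          snd (O_bar v (\<lambda>x. \<epsilon> * f x)) w y \<le> \<epsilon> * (g w y - 2 * log_abs y s))" if "w \<in> places" for w
        using f[OF that] \<open>\<epsilon> > 0\<close> by (simp add: O_bar_times)
    qed
    then show ?thesis
      using that mu by (simp add: ereal_divide_le_pos)
  qed
  then show "\<forall>\<^sub>F \<epsilon> in at_right 0. (mu_max_asy \<iota> X \<zeta> (adelic_add (D, g) (O_bar v (\<lambda>x. \<epsilon> * f x))) -
      mu_max_asy \<iota> X \<zeta> (D, g)) / ereal \<epsilon> \<le> 0"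
    by (simp add: eventually_at_filter)
qed

section \<open>From the norm at a point to a uniform lower bound nearby\<close>

text \<open>A limit superior below c < 1 keeps exp(log|s| - g/2) below c near \<open>x\<close>;
  taking -2 log gives the bound with \<delta> = -2 log c.\<close>

lemma section_norm_less_1E:
  assumes "section_norm \<iota> X v (D, g) s x < 1" "x \<in> topspace (an_topology \<iota> X v)"
  obtains W \<delta> where "openin (an_topology \<iota> X v) W" "x \<in> W" "\<delta> > 0"
    "\<And>y. y \<in> W \<Longrightarrow> centre y \<notin> rsupport X D \<Longrightarrow> units_at s (centre y) \<Longrightarrow>
      \<delta> \<le> g v y - 2 * log_abs y s"
proof -
  \<comment> \<open>The norm can be 0, for instance where s vanishes; comparing with 1/2 forces c >
    0, so that its logarithm is meaningful.\<close>
  have "ereal (1 / 2) < 1"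
    unfolding one_ereal_def less_ereal.simps by simp
  then have "max (ereal (1 / 2)) (section_norm \<iota> X v (D, g) s x) < 1"
    using assms(1) by simp
  then obtain c where c: "max (ereal (1 / 2)) (section_norm \<iota> X v (D, g) s x) < ereal c" "ereal c < 1"
    using ereal_dense2 by blast
  then have "ereal (1 / 2) < ereal c"
    by (simp only: max_less_iff_conj)
  then have c01: "0 < c" "c < 1"
    using c(2) by (simp_all only: one_ereal_def less_ereal.simps)
  have "section_norm \<iota> X v (D, g) s x < ereal c"
    using c(1) by simp
  then have "\<forall>\<^sub>F y in inf_class.inf (nhdsin (an_topology \<iota> X v) x)
      (principal {y. centre y \<notin> rsupport X D \<and> units_at s (centre y)}).
      ereal (exp (log_abs y s) * exp (- g v y / 2)) < ereal c"
    unfolding section_norm_def by (intro Limsup_lessD) simp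
  then obtain W where W: "openin (an_topology \<iota> X v) W" "x \<in> W"
    "\<forall>y\<in>W. centre y \<notin> rsupport X D \<and> units_at s (centre y) \<longrightarrow>
      exp (log_abs y s) * exp (- g v y / 2) < c"
    using assms(2) by (auto simp: eventually_inf_principal eventually_nhdsin)
  show thesis
  proof (rule that[OF W(1,2)])
    show "- 2 * ln c > 0"
      using c01 by simp
    fix y assume "y \<in> W" "centre y \<notin> rsupport X D" "units_at s (centre y)"
    then have "exp (log_abs y s) * exp (- g v y / 2) < c"
      using W(3) by blast
    then have "exp (log_abs y s + - g v y / 2) < exp (ln c)"
      using c01 by (simp only: exp_add exp_ln)
    then show "- 2 * ln c \<le> g v y - 2 * log_abs y s"
      by simp
  qed
qed

section \<open>Complex conjugation and the symmetrised perturbation\<close>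

lemma log_abs_conj_point: "log_abs (conj_point y) s = log_abs y s"
proof -
  have "abs_at (conj_point y) f = abs_at y f" for f
    by (cases y) auto
  then show ?thesis by (simp add: log_abs_def)
qed

lemma centre_conj_point: "centre (conj_point y) = centre y"
  by (cases y) auto

lemma conj_point_conj_point: "conj_point (conj_point y) = y"
  by (cases y) auto

lemma conj_point_in_an_points:
  fixes \<iota> :: "'k::field_char_0 \<Rightarrow> 'f::field"
  assumes "y \<in> an_points \<iota> X (conj_place v)"
  shows "conj_point y \<in> an_points \<iota> X v"
proof (cases v)
  case (Finite_place p)
  then show ?thesis using assms by auto
next
  case (Infinite_place \<sigma>)
  then obtain P e where y: "y = Complex_point P e" "P \<in> X"
    and e: "complex_evaluation \<iota> (\<lambda>a. cnj (\<sigma> a)) P e"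
    using assms by auto
  have "complex_evaluation \<iota> \<sigma> P (\<lambda>f. cnj (e f))"
    using e by (auto simp: complex_evaluation_def ring_hom_def ring_on_def)
  then show ?thesis using y Infinite_place by simp
qed

text \<open>At an infinite place \<open>O_bar\<close> puts half of f at v and half of its conjugate
  at the conjugate place. The bound moves to the conjugate place because g is conjugation invariant
  off the support and log|s| is too. For a real place the halves add up; otherwise one half, or 0,
  is compared with a non-negative right-hand side.\<close>

lemma O_bar_le:
  assumes "adelic_divisor \<iota> X (D, g)" "v \<in> places"
    and U: "U \<inter> rsupport X D = {}"
    and f: "\<And>y. y \<in> an_points \<iota> X v \<Longrightarrow> 0 \<le> f y"
      "\<And>y. y \<in> an_points \<iota> X v \<Longrightarrow> centre y \<in> U \<Longrightarrow> f y \<le> g v y - 2 * log_abs y s"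
    and y: "y \<in> an_points \<iota> X w" "centre y \<in> U" and "0 \<le> g w y - 2 * log_abs y s"
  shows "snd (O_bar v f) w y \<le> g w y - 2 * log_abs y s"
proof (cases v)
  case (Finite_place p)
  then show ?thesis
    using assms by (auto simp: O_bar_def)
next
  case (Infinite_place \<sigma>)
  then have "is_ring_hom \<sigma>"
    using assms(2) by (auto simp: places_def)
  then have inv: "\<forall>x\<in>an_points \<iota> X (Infinite_place \<sigma>). centre x \<notin> rsupport X D \<longrightarrow>
      g (conj_place (Infinite_place \<sigma>)) (conj_point x) = g (Infinite_place \<sigma>) x"
    using assms(1) unfolding adelic_divisor_def by blast
  have *: "f (conj_point y) \<le> g w y - 2 * log_abs y s" if "w = conj_place v"
  proof -
    have y': "conj_point y \<in> an_points \<iota> X v"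
      using y that conj_point_in_an_points by blast
    \<comment> \<open>Invariance is stated for points over v, so it is applied to the conjugate of
      \<open>y\<close>, and conjugating twice returns to \<open>y\<close>.\<close>
    have "g (conj_place v) (conj_point (conj_point y)) = g v (conj_point y)"
      using inv y' U y(2) Infinite_place
      by (metis IntI centre_conj_point emptyE)
    then show ?thesis
      using f(2)[OF y'] y(2) that
      by (simp add: conj_point_conj_point log_abs_conj_point centre_conj_point)
  qed
  have **: "f y \<le> g w y - 2 * log_abs y s" if "w = v"
    using f(2)[of y] y that by simp
  have "snd (O_bar v f) w y =
      (if w = v then f y / 2 else 0) + (if w = conj_place v then f (conj_point y) / 2 else 0)"
    using Infinite_place by (simp add: O_bar_def)
  then show ?thesis
    using * ** assms(8) by (auto split: if_splits)
qed

section \<open>The truncated bump function and the contradiction at a support point\<close>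

theorem corollary5p2p3:
  fixes \<iota> :: "'k::field_char_0 \<Rightarrow> 'f::field"
    and X :: "'f set set"
    and D :: "'f divisor \<Rightarrow>\<^sub>0 real"
    and g :: "('k, 'f) green_family"
    and \<zeta> :: "'k place \<Rightarrow> real"
    and s :: "'f \<Rightarrow>\<^sub>0 real"
    and v :: "'k place"
  assumes "number_field TYPE('k)"
    and "is_ring_hom \<iota>"
    and "integral_projective \<iota> UNIV X"
    and "geometrically_integral \<iota> X"
    and "adelic_divisor \<iota> X (D, g)"
    and "big_rdivisor \<iota> X D"
    and "adelic_base_divisor \<zeta>" and "arakelov_degree \<zeta> = 1"
    and "mu_max_asy \<iota> X \<zeta> (D, g) = 0"
    and "s \<in> rrational"
    and "adelic_nonneg \<iota> X (adelic_add (D, g) (adelic_principal X s))"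
    and "v \<in> places"
  shows "functional_support \<iota> X v (Psi_mu \<iota> X \<zeta> (D, g) v) \<inter>
           {x \<in> an_points \<iota> X v. section_norm \<iota> X v (D, g) s x < 1} = {}"
proof (rule ccontr)
  note proj = assms(3)
  note subr = integral_projective_subring[OF proj]
  have generic: "UNIV \<in> X"
    using proj by (simp add: integral_projective_def)
  note top = topspace_an_topology[OF subr, of X \<iota> v]
  assume "\<not> ?thesis"
  then obtain x where supp: "x \<in> functional_support \<iota> X v (Psi_mu \<iota> X \<zeta> (D, g) v)"
    and x: "x \<in> an_points \<iota> X v" and "section_norm \<iota> X v (D, g) s x < 1"
    by auto
  then obtain W \<delta> where W: "openin (an_topology \<iota> X v) W" "x \<in> W" and \<delta>: "\<delta> > 0"
    "\<And>y. y \<in> W \<Longrightarrow> centre y \<notin> rsupport X D \<Longrightarrow> units_at s (centre y) \<Longrightarrow>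
      \<delta> \<le> g v y - 2 * log_abs y s"
    using section_norm_less_1E[of \<iota> X v D g s x] top by auto
  obtain F where F: "continuous_map (an_topology \<iota> X v) euclideanreal F"
    "\<And>y. y \<in> an_points \<iota> X v \<Longrightarrow> 0 \<le> F y" "0 < F x"
    "\<And>y. y \<in> an_points \<iota> X v \<Longrightarrow> y \<notin> W \<Longrightarrow> F y = 0"
    using cozero_nbhd_openin[OF proj x W] top unfolding cozero_nbhd_def by auto
  \<comment> \<open>\<open>F\<close> may exceed g_v - 2 log|s| on \<open>W\<close>; truncation at
    \<open>\<delta>\<close> keeps f below it there and does not affect continuity or positivity at
    x.\<close>
  define f where "f = (\<lambda>y. min \<delta> (F y))"
  have f_cont: "continuous_map (an_topology \<iota> X v) euclideanreal f"
    unfolding f_def by (intro continuous_map_real_min continuous_map_canonical_const F(1))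
  have f_nonneg: "0 \<le> f y" if "y \<in> an_points \<iota> X v" for y
    using \<delta>(1) F(2)[OF that] by (simp add: f_def)
  have f_x: "0 < f x"
    using \<delta>(1) F(3) by (simp add: f_def)
  have a_pos: "\<exists>U. openin (zariski X) U \<and> UNIV \<in> U \<and>
      (\<forall>y\<in>an_points \<iota> X w. centre y \<in> U \<longrightarrow> 0 \<le> g w y - 2 * log_abs y s)" if w: "w \<in> places" for w
  proof -
    obtain U where "openin (zariski X) U" "UNIV \<in> U" "\<And>y. y \<in> an_points \<iota> X w \<Longrightarrow> centre y \<in> U \<Longrightarrow>
        0 \<le> snd (adelic_add (D, g) (adelic_principal X s)) w y"
      by (rule adelic_nonneg_generic[OF generic assms(11) w]) (rule that)
    then show ?thesis
      by (intro exI[of _ U]) (simp add: adelic_add_def adelic_principal_def)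
  qed
  obtain U\<^sub>v where U\<^sub>v: "openin (zariski X) U\<^sub>v" "UNIV \<in> U\<^sub>v"
    "\<And>y. y \<in> an_points \<iota> X v \<Longrightarrow> centre y \<in> U\<^sub>v \<Longrightarrow> 0 \<le> g v y - 2 * log_abs y s"
    using a_pos[OF assms(12)] by blast
  have "D \<in> rdivisors X"
    using assms(5) by (simp add: adelic_divisor_def)
  then obtain U\<^sub>D where U\<^sub>D: "openin (zariski X) U\<^sub>D" "UNIV \<in> U\<^sub>D" "U\<^sub>D \<inter> rsupport X D = {}"
    using openin_off_rsupport[OF generic subr] by blast
  obtain U\<^sub>s where U\<^sub>s: "openin (zariski X) U\<^sub>s" "UNIV \<in> U\<^sub>s"
    "\<And>P. P \<in> U\<^sub>s \<Longrightarrow> P \<in> X \<and> Poly_Mapping.keys s \<subseteq> local_units P"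
    using openin_zariski_units[of "Poly_Mapping.keys s" X] assms(10) generic
    by (auto simp: rrational_def)
  \<comment> \<open>Over \<open>U\<^sub>v\<close> the Green function of D + (s) is non-negative,
    which covers points off \<open>W\<close>. Over \<open>U\<^sub>D\<close> and
    \<open>U\<^sub>s\<close> both g and log|s| are meaningful, as the lower bound
    \<open>\<delta>\<close> on \<open>W\<close> requires.\<close>
  define U where "U = U\<^sub>v \<inter> U\<^sub>D \<inter> U\<^sub>s"
  have U: "openin (zariski X) U" "UNIV \<in> U" "U \<inter> rsupport X D = {}"
    using U\<^sub>v U\<^sub>D U\<^sub>s by (auto simp: U_def)
  have f_le: "f y \<le> g v y - 2 * log_abs y s" if "y \<in> an_points \<iota> X v" "centre y \<in> U" for y
  proof (cases "y \<in> W")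
    case True
    have "centre y \<notin> rsupport X D" "units_at s (centre y)"
      using that U(3) U\<^sub>s(3)[of "centre y"] by (auto simp: U_def units_at_def)
    then show ?thesis
      using \<delta>(2)[OF True] by (simp add: f_def)
  next
    case False
    then show ?thesis
      using F(4)[OF that(1)] U\<^sub>v(3)[OF that(1)] that(2) by (simp add: f_def U_def)
  qed
  have "Psi_mu \<iota> X \<zeta> (D, g) v f \<le> 0"
  proof (rule Psi_mu_nonpos[OF generic assms(10,11,9)])
    fix w :: "'k place" assume w: "w \<in> places"
    \<comment> \<open>Non-negativity at w holds over an open set that depends on w, so the set for v
      alone is not enough when w is another place.\<close>
    obtain U\<^sub>w where U\<^sub>w: "openin (zariski X) U\<^sub>w" "UNIV \<in> U\<^sub>w"
      "\<And>y. y \<in> an_points \<iota> X w \<Longrightarrow> centre y \<in> U\<^sub>w \<Longrightarrow> 0 \<le> g w y - 2 * log_abs y s"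
      using a_pos[OF w] by blast
    have "snd (O_bar v f) w y \<le> g w y - 2 * log_abs y s"
      if "y \<in> an_points \<iota> X w" "centre y \<in> U\<^sub>w \<inter> U" for y
      using that U\<^sub>w(3)[of y] by (intro O_bar_le[OF assms(5,12) U(3) f_nonneg f_le]) auto
    then show "\<exists>U. openin (zariski X) U \<and> U \<noteq> {} \<and>
        (\<forall>y\<in>an_points \<iota> X w. centre y \<in> U \<longrightarrow> snd (O_bar v f) w y \<le> g w y - 2 * log_abs y s)"
      using U U\<^sub>w by (intro exI[of _ "U\<^sub>w \<inter> U"]) auto
  qed
  moreover have "0 < Psi_mu \<iota> X \<zeta> (D, g) v f"
    using supp f_cont f_nonneg f_x by (simp add: functional_support_def)
  ultimately show False
    by simp
qed

end
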